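(* Let $M=M^{n|m}$ be a supermanifold. For every $\omega\in\Omega^k(M)$ and every mixed form $\mathcal L\in\Omega^{r|s}_{p|q}(M)$ the Leibniz formula holds: $$\bar d(\omega\,\mathcal L)=d\omega\,\mathcal L+(-1)^k\,\omega\,\bar d\mathcal L,$$ where $d$ is the differential on naive differential forms, $\bar d$ is the differential on mixed forms, and the product of a naive form with a mixed form is the module structure generated by multiplication by functions and the operators $e(\alpha)$, $\alpha\in\Omega^1(M)$.
   Context: Conventions. $\tilde{\ }$ denotes parity; repeated indices are summed; derivatives act from the left; $\Pi$ is parity reversion; $\mathrm{Ber}$ is the Berezinian; $x^A$ are local coordinates on $M$. All matrices below are even, i.e. an entry has parity equal to the sum of the parities of its two indices. Mixed forms on a superspace. For a vector superspace $V$ of dimension $n|m$, with $\mathrm{Vol}\,V=\mathrm{Ber}\,V^*$ (elements written by their coefficient in a chosen basis), $\Lambda^{r|s}_{p|q}(V)$ is the space of smooth $\mathrm{Vol}\,V$-valued maps $\mathcal L(p,w)$ of $p$ even and $q$ odd covectors on $V\oplus\mathbb R^{r|s}$ (points of $((V\oplus\mathbb R^{r|s})^* )^p\times((V\oplus\mathbb R^{r|s})^*\Pi)^q$), defined at arguments for which the Berezinian conditions make sense (odd covectors, and odd rows of $w$, linearly independent). The matrices are $p=(p_A{}^K)$, $w=(w_F{}^K)$, where $K$ runs over $p|q$ values and numbers the covectors (columns), $F$ runs over $r|s$ values, and $p$ is placed over $w$. The conditions are: $\mathcal L(ph,wh)=\mathcal L(p,w)\,\mathrm{Ber}\,h$ for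 $h\in GL(p|q)$; $\mathcal L(p+aw,gw)=\mathcal L(p,w)\,\mathrm{Ber}\,g$ for $g\in GL(r|s)$ and all matrices $a=(a_A{}^F)$ with $n|m$ rows and $r|s$ columns; and $$\frac{\partial^2\mathcal L}{\partial p_A{}^K\partial p_B{}^L}+(-1)^{\tilde A\tilde B+(\tilde A+\tilde B)\tilde L}\frac{\partial^2\mathcal L}{\partial p_B{}^K\partial p_A{}^L}=0,$$ $$\frac{\partial^2\mathcal L}{\partial p_A{}^K\partial w_F{}^L}+(-1)^{\tilde A\tilde F+(\tilde A+\tilde F)\tilde L}\frac{\partial^2\mathcal L}{\partial w_F{}^K\partial p_A{}^L}=0,$$ $$\frac{\partial^2\mathcal L}{\partial w_F{}^K\partial w_G{}^L}+(-1)^{\tilde F\tilde G+(\tilde F+\tilde G)\tilde L}\frac{\partial^2\mathcal L}{\partial w_G{}^K\partial w_F{}^L}=0 .$$ Mixed forms on $M$. $\Omega^{r|s}_{p|q}(M)$ is the space of sections of the corresponding bundle associated with $TM$ (fiber $\Lambda^{r|s}_{p|q}(T_xM)$); in local coordinates $\mathcal L=\mathcal L(x,p,w)$. The differential $\bar d:\Omega^{r|s}_{p|q}\to\Omega^{r+1|s}_{p|q}$ is the (well-defined, square-zero, even) operator $$\bar d\mathcal L=(-1)^r\,w_{r+1}{}^K(-1)^{\tilde A\tilde K}\frac{\partial}{\partial x^A}\frac{\partial\mathcal L}{\partial p_A{}^K},$$ where $w_{r+1}$ is the additional (last even) row and $K$ runs over all $p|q$ columns. Naive differential forms. $\Omega^\bullet(M)=\oplus_k\Omega^k(M)$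 is the algebra locally generated over functions by $dx^A$ with the skew-commutative convention: $dx^A$ has the parity $\tilde A$ of $x^A$, and $\alpha\beta=-(-1)^{\tilde\alpha\tilde\beta}\beta\alpha$ for 1-forms (in particular the flip of $dx^A$ and $dx^B$ gives $-(-1)^{\tilde A\tilde B}$). Its differential $d$ is even, $df=dx^A\,\partial_Af$, $d^2=0$, $d(\omega\eta)=d\omega\,\eta+(-1)^k\omega\,d\eta$ for $\omega\in\Omega^k$. Module structure. A function $f$ acts on mixed forms by multiplication, and a 1-form $\alpha=dx^A\alpha_A$ acts by $\alpha\,\mathcal L:=e(\alpha)\mathcal L$, where $e(\alpha):\Omega^{r|s}_{p|q}\to\Omega^{r+1|s}_{p|q}$, $$e(\alpha)\mathcal L=(-1)^r\alpha_A\,w_{r+1}{}^K(-1)^{\tilde\alpha\tilde A}\frac{\partial\mathcal L}{\partial p_A{}^K}.$$ Since $e(\alpha)e(\beta)=-(-1)^{\tilde\alpha\tilde\beta}e(\beta)e(\alpha)$, this makes mixed forms (with fixed $s$, $p|q$) a module over $\Omega^\bullet(M)$. *)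

theory Defs
  imports "HOL-Analysis.Analysis" "HOL-Library.Function_Algebras"
begin

section \<open>Grassmann algebras\<close>

text \<open>
  An element is given by its coefficients at the monomials \<open>\<xi>\<^sub>S\<close> (product of the generators
  \<open>\<xi>\<^sub>i\<close>, \<open>i \<in> S\<close>, in increasing order), \<open>S\<close> a finite set of naturals.  No finiteness of the number of
  nonzero coefficients is imposed on the type; only elements of finitely generated subalgebras
  are ever used (\<open>Lam N\<close> below, and the values of superfunctions).
\<close>

typedef grass = "{f :: nat set \<Rightarrow> real. \<forall>S. infinite S \<longrightarrow> f S = 0}"
  morphisms coef Abs_grass
  by (rule exI[of _ "\<lambda>_. 0"]) simp

definition mk_grass :: "(nat set \<Rightarrow> real) \<Rightarrow> grass" where
  "mk_grass f = Abs_grass (\<lambda>S. if finite S then f S else 0)"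

lemma coef_mk_grass: "coef (mk_grass f) S = (if finite S then f S else 0)"
  unfolding mk_grass_def by (subst Abs_grass_inverse) auto

lemma coef_infinite: "infinite S \<Longrightarrow> coef g S = 0"
  using coef[of g] by auto

lemma grass_eqI: "(\<And>S. finite S \<Longrightarrow> coef g S = coef h S) \<Longrightarrow> g = h"
  by (metis coef_infinite coef_inject ext)

text \<open>\<open>\<xi>\<^sub>S \<xi>\<^sub>T = gsign S T \<xi>\<^sub>S\<^sub>\<union>\<^sub>T\<close> for disjoint \<open>S\<close>, \<open>T\<close>.\<close>

definition gsign :: "nat set \<Rightarrow> nat set \<Rightarrow> real" where
  "gsign S T = (-1) ^ card {(i, j). i \<in> S \<and> j \<in> T \<and> j < i}"

lemma gsign_empty [simp]: "gsign {} T = 1" "gsign S {} = 1"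
  by (simp_all add: gsign_def)

lemma gsign_finite:
  assumes "finite S" "finite T"
  shows "finite {(i::nat, j::nat). i \<in> S \<and> j \<in> T \<and> j < i}"
  by (rule finite_subset[of _ "S \<times> T"]) (use assms in auto)

lemma gsign_Un_left:
  assumes "finite S" "finite T" "finite R" "S \<inter> T = {}"
  shows "gsign (S \<union> T) R = gsign S R * gsign T R"
proof -
  have "{(i, j). i \<in> S \<union> T \<and> j \<in> R \<and> j < i}
      = {(i, j). i \<in> S \<and> j \<in> R \<and> j < i} \<union> {(i, j). i \<in> T \<and> j \<in> R \<and> j < i}"
    by auto
  moreover have "{(i, j). i \<in> S \<and> j \<in> R \<and> j < i} \<inter> {(i, j). i \<in> T \<and> j \<in> R \<and> j < i} = {}"
    using assms(4) by auto
  ultimately show ?thesis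
    unfolding gsign_def using assms
    by (simp add: card_Un_disjoint gsign_finite flip: power_add)
qed

lemma gsign_Un_right:
  assumes "finite S" "finite T" "finite R" "T \<inter> R = {}"
  shows "gsign S (T \<union> R) = gsign S T * gsign S R"
proof -
  have "{(i, j). i \<in> S \<and> j \<in> T \<union> R \<and> j < i}
      = {(i, j). i \<in> S \<and> j \<in> T \<and> j < i} \<union> {(i, j). i \<in> S \<and> j \<in> R \<and> j < i}"
    by auto
  moreover have "{(i, j). i \<in> S \<and> j \<in> T \<and> j < i} \<inter> {(i, j). i \<in> S \<and> j \<in> R \<and> j < i} = {}"
    using assms(4) by auto
  ultimately show ?thesis
    unfolding gsign_def using assms
    by (simp add: card_Un_disjoint gsign_finite flip: power_add)
qed

instantiation grass :: real_algebra_1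
begin

definition "0 = mk_grass (\<lambda>_. 0)"
definition "1 = mk_grass (\<lambda>S. if S = {} then 1 else 0)"
definition "g + h = mk_grass (\<lambda>S. coef g S + coef h S)"
definition "g - h = mk_grass (\<lambda>S. coef g S - coef h S)"
definition "- g = mk_grass (\<lambda>S. - coef g S)"
definition "c *\<^sub>R g = mk_grass (\<lambda>S. c * coef g S)"
definition "g * h = mk_grass (\<lambda>U. \<Sum>S\<in>Pow U. gsign S (U - S) * coef g S * coef h (U - S))"

lemma coef_simps:
  "coef 0 S = 0"
  "coef 1 S = (if S = {} then 1 else 0)"
  "coef (g + h) S = coef g S + coef h S"
  "coef (g - h) S = coef g S - coef h S"
  "coef (- g) S = - coef g S"
  "coef (c *\<^sub>R g) S = c * coef g S"
  by (auto simp: zero_grass_def one_grass_def plus_grass_def minus_grass_def uminus_grass_def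
      scaleR_grass_def coef_mk_grass coef_infinite)

lemma coef_mult:
  "coef (g * h) U = (\<Sum>S\<in>Pow U. gsign S (U - S) * coef g S * coef h (U - S))"
  by (auto simp: times_grass_def coef_mk_grass)

instance
proof
  fix a b c :: grass and x y :: real
  show "a + b + c = a + (b + c)" "a + b = b + a" "0 + a = a" "- a + a = 0" "a - b = a + - b"
    "x *\<^sub>R (a + b) = x *\<^sub>R a + x *\<^sub>R b" "(x + y) *\<^sub>R a = x *\<^sub>R a + y *\<^sub>R a"
    "x *\<^sub>R y *\<^sub>R a = (x * y) *\<^sub>R a" "1 *\<^sub>R a = a"
    by (auto intro!: grass_eqI simp: coef_simps algebra_simps)
  show "(a + b) * c = a * c + b * c" "a * (b + c) = a * b + a * c"
    "(x *\<^sub>R a) * b = x *\<^sub>R (a * b)" "a * (x *\<^sub>R b) = x *\<^sub>R (a * b)"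
    by (auto intro!: grass_eqI
        simp: coef_simps coef_mult algebra_simps sum.distrib sum_distrib_left)
  show "(0 :: grass) \<noteq> 1"
    by (metis coef_simps(1,2) zero_neq_one)
  show "1 * a = a"
  proof (rule grass_eqI)
    fix U :: "nat set" assume "finite U"
    have "coef (1 * a) U = (\<Sum>S\<in>Pow U. if S = {} then coef a U else 0)"
      unfolding coef_mult by (rule sum.cong) (auto simp: coef_simps)
    also have "\<dots> = coef a U"
      using \<open>finite U\<close> by simp
    finally show "coef (1 * a) U = coef a U" .
  qed
  show "a * 1 = a"
  proof (rule grass_eqI)
    fix U :: "nat set" assume "finite U"
    have "coef (a * 1) U = (\<Sum>S\<in>Pow U. if S = U then coef a U else 0)"
      unfolding coef_mult by (rule sum.cong) (auto simp: coef_simps)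
    also have "\<dots> = coef a U"
      using \<open>finite U\<close> by simp
    finally show "coef (a * 1) U = coef a U" .
  qed
  show "a * b * c = a * (b * c)"
  proof (rule grass_eqI)
    fix U :: "nat set" assume U: "finite U"
    have "coef (a * b * c) U = (\<Sum>R\<in>Pow U. \<Sum>S\<in>Pow R.
        gsign R (U - R) * (gsign S (R - S) * coef a S * coef b (R - S)) * coef c (U - R))"
      unfolding coef_mult by (simp add: sum_distrib_left sum_distrib_right)
    also have "\<dots> = (\<Sum>(R, S)\<in>Sigma (Pow U) Pow.
        gsign R (U - R) * (gsign S (R - S) * coef a S * coef b (R - S)) * coef c (U - R))"
      using U by (subst sum.Sigma) (auto intro: finite_subset)
    also have "\<dots> = (\<Sum>(S, T)\<in>Sigma (Pow U) (\<lambda>S. Pow (U - S)).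
        gsign S (U - S) * coef a S * (gsign T (U - S - T) * coef b T * coef c (U - S - T)))"
    proof (rule sum.reindex_bij_witness[of _ "\<lambda>(S, T). (S \<union> T, S)" "\<lambda>(R, S). (S, R - S)"],
        goal_cases)
      case (5 RS)
      then obtain R S where RS: "RS = (R, S)" "S \<subseteq> R" "R \<subseteq> U" by auto
      have fin: "finite R" "finite S" using RS U finite_subset by metis+
      have "gsign R (U - R) = gsign S (U - R) * gsign (R - S) (U - R)"
        using gsign_Un_left[of S "R - S" "U - R"] fin U RS by (simp add: Un_absorb1)
      moreover have "gsign S (U - S) = gsign S (R - S) * gsign S (U - R)"
      proof -
        have "(R - S) \<union> (U - R) = U - S" using RS by auto
        then show ?thesis using gsign_Un_right[of S "R - S" "U - R"] fin U by auto
      qed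
      moreover have "U - S - (R - S) = U - R" using RS by auto
      ultimately show ?case using RS(1) by simp
    qed auto
    also have "\<dots> = (\<Sum>S\<in>Pow U. \<Sum>T\<in>Pow (U - S).
        gsign S (U - S) * coef a S * (gsign T (U - S - T) * coef b T * coef c (U - S - T)))"
      using U by (subst sum.Sigma) auto
    also have "\<dots> = coef (a * (b * c)) U"
      unfolding coef_mult by (simp add: sum_distrib_left)
    finally show "coef (a * b * c) U = coef (a * (b * c)) U" .
  qed
qed

end

definition gen :: "nat \<Rightarrow> grass" where
  "gen i = mk_grass (\<lambda>S. if S = {i} then 1 else 0)"

definition body :: "grass \<Rightarrow> real" where
  "body g = coef g {}"

definition soul :: "grass \<Rightarrow> grass" where
  "soul g = g - of_real (body g)"

text \<open>Parities are natural numbers, read modulo 2.\<close>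

definition has_parity :: "nat \<Rightarrow> grass \<Rightarrow> bool" where
  "has_parity e g \<longleftrightarrow> (\<forall>S. coef g S \<noteq> 0 \<longrightarrow> card S mod 2 = e mod 2)"

definition parity_part :: "nat \<Rightarrow> grass \<Rightarrow> grass" where
  "parity_part e g = mk_grass (\<lambda>S. if card S mod 2 = e mod 2 then coef g S else 0)"

definition Lam :: "nat \<Rightarrow> grass set" where
  "Lam N = {g. \<forall>S. coef g S \<noteq> 0 \<longrightarrow> S \<subseteq> {..<N}}"

definition left_deriv :: "nat \<Rightarrow> grass \<Rightarrow> grass" where
  "left_deriv i g = mk_grass (\<lambda>S. if i \<in> S then 0 else gsign {i} S * coef g (insert i S))"


section \<open>Indices, even matrices, Berezinian\<close>

text \<open>
  The indices running over \<open>n|m\<close> values are \<open>Ev 0, \<dots>, Ev (n-1), Od 0, \<dots>, Od (m-1)\<close>; in particular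
  the last even row \<open>w\<^sub>r\<^sub>+\<^sub>1\<close> has index \<open>Ev r\<close>.
\<close>

datatype idx = Ev nat | Od nat

fun par :: "idx \<Rightarrow> nat" where
  "par (Ev _) = 0"
| "par (Od _) = 1"

definition Idx :: "nat \<Rightarrow> nat \<Rightarrow> idx set" where
  "Idx n m = Ev ` {..<n} \<union> Od ` {..<m}"

instantiation idx :: linorder
begin

fun less_eq_idx :: "idx \<Rightarrow> idx \<Rightarrow> bool" where
  "less_eq_idx (Ev a) (Ev b) \<longleftrightarrow> a \<le> b"
| "less_eq_idx (Ev a) (Od b) \<longleftrightarrow> True"
| "less_eq_idx (Od a) (Ev b) \<longleftrightarrow> False"
| "less_eq_idx (Od a) (Od b) \<longleftrightarrow> a \<le> b"

definition less_idx :: "idx \<Rightarrow> idx \<Rightarrow> bool" where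
  "less_idx A B \<longleftrightarrow> A \<le> B \<and> \<not> B \<le> A"

instance
proof
  fix A B C :: idx
  show "A < B \<longleftrightarrow> A \<le> B \<and> \<not> B \<le> A" by (rule less_idx_def)
  show "A \<le> A" by (cases A) auto
  show "A \<le> B \<Longrightarrow> B \<le> C \<Longrightarrow> A \<le> C" by (cases A; cases B; cases C) auto
  show "A \<le> B \<Longrightarrow> B \<le> A \<Longrightarrow> A = B" by (cases A; cases B) auto
  show "A \<le> B \<or> B \<le> A" by (cases A; cases B) auto
qed

end

type_synonym gmatrix = "idx \<Rightarrow> idx \<Rightarrow> grass"

definition even_matrix :: "nat \<Rightarrow> idx set \<Rightarrow> idx set \<Rightarrow> gmatrix \<Rightarrow> bool" where
  "even_matrix N I J h \<longleftrightarrow> (\<forall>A\<in>I. \<forall>B\<in>J. h A B \<in> Lam N \<and> has_parity (par A + par B) (h A B))"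

definition GL :: "nat \<Rightarrow> nat \<Rightarrow> nat \<Rightarrow> gmatrix set" where
  "GL N p q = {h. even_matrix N (Idx p q) (Idx p q) h \<and>
     (\<exists>h'. even_matrix N (Idx p q) (Idx p q) h' \<and>
       (\<forall>A\<in>Idx p q. \<forall>B\<in>Idx p q.
          (\<Sum>C\<in>Idx p q. h A C * h' C B) = (if A = B then 1 else 0) \<and>
          (\<Sum>C\<in>Idx p q. h' A C * h C B) = (if A = B then 1 else 0)))}"

text \<open>The entries of the matrices below are even, hence commute; the Leibniz formula is unambiguous.\<close>

definition gdet :: "nat \<Rightarrow> (nat \<Rightarrow> nat \<Rightarrow> grass) \<Rightarrow> grass" where
  "gdet k D = (\<Sum>\<pi> | \<pi> permutes {..<k}. of_int (sign \<pi>) * prod_list (map (\<lambda>i. D i (\<pi> i)) [0..<k]))"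

definition ginverse :: "nat \<Rightarrow> (nat \<Rightarrow> nat \<Rightarrow> grass) \<Rightarrow> nat \<Rightarrow> nat \<Rightarrow> grass" where
  "ginverse k D = (THE E. (\<forall>i j. k \<le> i \<or> k \<le> j \<longrightarrow> E i j = 0) \<and>
     (\<forall>i<k. \<forall>j<k. (\<Sum>l<k. D i l * E l j) = (if i = j then 1 else 0) \<and>
                   (\<Sum>l<k. E i l * D l j) = (if i = j then 1 else 0)))"

definition Ber :: "nat \<Rightarrow> nat \<Rightarrow> gmatrix \<Rightarrow> grass" where
  "Ber p q h =
     (let E = ginverse q (\<lambda>a b. h (Od a) (Od b)) in
      gdet p (\<lambda>i j. h (Ev i) (Ev j) - (\<Sum>a<q. \<Sum>b<q. h (Ev i) (Od a) * E a b * h (Od b) (Ev j)))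
      * gdet q E)"


section \<open>Superfunctions\<close>

text \<open>
  The variables are the coordinates \<open>x\<^sup>A\<close> (\<open>X A\<close>), the components \<open>p\<^sub>A\<^sup>K\<close> (\<open>P A K\<close>) and
  \<open>w\<^sub>F\<^sup>K\<close> (\<open>W F K\<close>).  The odd variable \<open>v\<close> is the Grassmann generator number \<open>to_nat v\<close>; a
  superfunction sends a value of the even variables to an element of the Grassmann algebra of the
  odd ones.  Points are functions on all variables, of which only finitely many even ones matter
  (see \<open>superfun\<close>), so that domains are cylinders.
\<close>

datatype var = X idx | P idx idx | W idx idx

instance idx :: countable by countable_datatype
instance var :: countable by countable_datatype

fun vpar :: "var \<Rightarrow> nat" where
  "vpar (X A) = par A"
| "vpar (P A K) = (par A + par K) mod 2"
| "vpar (W F K) = (par F + par K) mod 2"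

type_synonym point = "var \<Rightarrow> real"
type_synonym sfun = "point \<Rightarrow> grass"

definition pd :: "var \<Rightarrow> (point \<Rightarrow> real) \<Rightarrow> point \<Rightarrow> real" where
  "pd v g x = deriv (\<lambda>t. g (x(v := t))) (x v)"

definition iter_pd :: "var list \<Rightarrow> (point \<Rightarrow> real) \<Rightarrow> point \<Rightarrow> real" where
  "iter_pd vs g = foldr pd vs g"

definition smooth :: "point set \<Rightarrow> (point \<Rightarrow> real) \<Rightarrow> bool" where
  "smooth U g \<longleftrightarrow> (\<forall>vs. continuous_on U (iter_pd vs g) \<and>
     (\<forall>v. \<forall>x\<in>U. (\<lambda>t. iter_pd vs g (x(v := t))) differentiable at (x v)))"

definition superfun :: "var set \<Rightarrow> point set \<Rightarrow> sfun set" where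
  "superfun V U = {f.
     (\<forall>x\<in>U. \<forall>S. coef (f x) S \<noteq> 0 \<longrightarrow> S \<subseteq> to_nat ` {v\<in>V. vpar v = 1}) \<and>
     (\<forall>x\<in>U. \<forall>y\<in>U. (\<forall>v\<in>V. vpar v = 0 \<longrightarrow> x v = y v) \<longrightarrow> f x = f y) \<and>
     (\<forall>S. smooth U (\<lambda>x. coef (f x) S)) \<and>
     (\<forall>x. x \<notin> U \<longrightarrow> f x = 0)}"

definition coord :: "var \<Rightarrow> sfun" where
  "coord v x = (if vpar v = 0 then of_real (x v) else gen (to_nat v))"

definition D :: "var \<Rightarrow> sfun \<Rightarrow> sfun" where
  "D v f x = (if vpar v = 0 then mk_grass (\<lambda>S. pd v (\<lambda>y. coef (f y) S) x)
              else left_deriv (to_nat v) (f x))"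

text \<open>
  Substitution of Grassmann elements \<open>z v\<close> (of parity \<open>vpar v\<close>) for the variables \<open>v \<in> V\<close> in a
  superfunction: Taylor expansion around the bodies of the even elements.  \<open>taylor V f z k\<close> is its
  part of order \<open>k\<close> in the souls; it vanishes for large \<open>k\<close>, the souls being nilpotent.
\<close>

definition taylor :: "var set \<Rightarrow> sfun \<Rightarrow> (var \<Rightarrow> grass) \<Rightarrow> nat \<Rightarrow> grass" where
  "taylor V f z k =
     (\<Sum>vs | length vs = k \<and> set vs \<subseteq> {v\<in>V. vpar v = 0}. \<Sum>S\<in>Pow (to_nat ` {v\<in>V. vpar v = 1}).
        (iter_pd vs (\<lambda>x. coef (f x) S) (\<lambda>v. body (z v)) / fact k) *\<^sub>R
        (prod_list (map (\<lambda>v. soul (z v)) vs) *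
         prod_list (map (\<lambda>i. z (from_nat i)) (sorted_list_of_set S))))"

definition subst :: "var set \<Rightarrow> sfun \<Rightarrow> (var \<Rightarrow> grass) \<Rightarrow> grass" where
  "subst V f z = (\<Sum>k | taylor V f z k \<noteq> 0. taylor V f z k)"

text \<open>The \<open>Lam N\<close>-points of the superdomain with coordinates \<open>V\<close> and underlying domain \<open>U\<close>.\<close>

definition gpoints :: "nat \<Rightarrow> var set \<Rightarrow> point set \<Rightarrow> (var \<Rightarrow> grass) set" where
  "gpoints N V U = {z. (\<forall>v\<in>V. z v \<in> Lam N \<and> has_parity (vpar v) (z v)) \<and> (\<lambda>v. body (z v)) \<in> U}"


section \<open>Supermanifolds\<close>

text \<open>
  A supermanifold is given by its underlying topological manifold together with an atlas:
  \<open>trans M i j A\<close> is the coordinate \<open>x\<^sup>A\<close> of chart \<open>i\<close> as a superfunction of the coordinates of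
  chart \<open>j\<close>.
\<close>

record ('a, 'i) supermfd =
  space_of :: "'a topology"
  charts :: "'i set"
  cdom :: "'i \<Rightarrow> 'a set"
  cmap :: "'i \<Rightarrow> 'a \<Rightarrow> nat \<Rightarrow> real"
  trans :: "'i \<Rightarrow> 'i \<Rightarrow> idx \<Rightarrow> sfun"

definition Xvars :: "nat \<Rightarrow> nat \<Rightarrow> var set" where
  "Xvars n m = X ` Idx n m"

definition base_point :: "nat \<Rightarrow> point \<Rightarrow> nat \<Rightarrow> real" where
  "base_point n x = (\<lambda>a. if a < n then x (X (Ev a)) else 0)"

text \<open>The set \<open>S \<inter> cdom M i\<close> in the coordinates of chart \<open>i\<close>.\<close>

definition region :: "nat \<Rightarrow> ('a, 'i) supermfd \<Rightarrow> 'i \<Rightarrow> 'a set \<Rightarrow> point set" where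
  "region n M i S = {x. base_point n x \<in> cmap M i ` (cdom M i \<inter> S)}"

text \<open>
  Composition of superfunctions is substitution at the generic point: the values \<open>\<phi> A x\<close> are themselves
  Grassmann elements.
\<close>

definition pull :: "nat \<Rightarrow> nat \<Rightarrow> (idx \<Rightarrow> sfun) \<Rightarrow> sfun \<Rightarrow> sfun" where
  "pull n m \<phi> f x = subst (Xvars n m) f (\<lambda>v. case v of X A \<Rightarrow> \<phi> A x | _ \<Rightarrow> 0)"

definition supermanifold :: "nat \<Rightarrow> nat \<Rightarrow> ('a, 'i) supermfd \<Rightarrow> bool" where
  "supermanifold n m M \<longleftrightarrow>
     Hausdorff_space (space_of M) \<and> second_countable (space_of M) \<and>
     (\<Union>i\<in>charts M. cdom M i) = topspace (space_of M) \<and>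
     (\<forall>i\<in>charts M. openin (space_of M) (cdom M i) \<and>
        openin (Euclidean_space n) (cmap M i ` cdom M i) \<and>
        homeomorphic_map (subtopology (space_of M) (cdom M i))
          (subtopology (Euclidean_space n) (cmap M i ` cdom M i)) (cmap M i)) \<and>
     (\<forall>i\<in>charts M. \<forall>j\<in>charts M. \<forall>A\<in>Idx n m.
        trans M i j A \<in> superfun (Xvars n m) (region n M j (cdom M i)) \<and>
        (\<forall>x. has_parity (par A) (trans M i j A x))) \<and>
     (\<forall>i\<in>charts M. \<forall>j\<in>charts M. \<forall>u\<in>cdom M i \<inter> cdom M j. \<forall>x. base_point n x = cmap M j u \<longrightarrow>
        (\<forall>a<n. body (trans M i j (Ev a) x) = cmap M i u a)) \<and>
     (\<forall>i\<in>charts M. \<forall>A\<in>Idx n m. \<forall>x\<in>region n M i UNIV. trans M i i A x = coord (X A) x) \<and>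
     (\<forall>i\<in>charts M. \<forall>j\<in>charts M. \<forall>k\<in>charts M. \<forall>A\<in>Idx n m.
        \<forall>x\<in>region n M k (cdom M i \<inter> cdom M j).
          trans M i k A x = pull n m (trans M j k) (trans M i j A) x)"


section \<open>Naive differential forms\<close>

text \<open>
  Locally \<open>\<Omega>\<^sup>\<bullet>\<close> is the free module over functions with basis the normally ordered monomials
  \<open>dx\<^sup>I = dx\<^sup>A\<^sup>1 \<dots> dx\<^sup>A\<^sup>k\<close>: sorted words \<open>I\<close> in which no even index is repeated (the \<open>dx\<^sup>A\<close> with \<open>A\<close> odd
  commute with each other and are not nilpotent).  A form is written \<open>\<Sum>\<^sub>I dx\<^sup>I \<omega>\<^sub>I\<close>, coefficients
  on the right.
\<close>

type_synonym lform = "idx list \<Rightarrow> sfun"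

definition normal_word :: "idx list \<Rightarrow> bool" where
  "normal_word I \<longleftrightarrow> sorted I \<and> distinct (filter (\<lambda>A. par A = 0) I)"

definition words :: "nat \<Rightarrow> nat \<Rightarrow> nat \<Rightarrow> idx list set" where
  "words n m k = {I. set I \<subseteq> Idx n m \<and> length I = k \<and> normal_word I}"

text \<open>
  \<open>dx\<^sup>I = word_sign I dx\<^sup>J\<close> with \<open>J = sort I\<close>, by \<open>dx\<^sup>A dx\<^sup>B = -(-1)\<^sup>A\<^sup>B dx\<^sup>B dx\<^sup>A\<close>.
\<close>

definition word_sign :: "idx list \<Rightarrow> real" where
  "word_sign I = (if distinct (filter (\<lambda>A. par A = 0) I)
     then \<Prod>(a, b) \<in> {(a, b). a < b \<and> b < length I \<and> I ! b < I ! a}. - ((-1) ^ (par (I ! a) * par (I ! b)))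
     else 0)"

text \<open>Moving a coefficient to the right of a monomial: \<open>f dx\<^sup>I = dx\<^sup>I move I f\<close>.\<close>

definition move :: "idx list \<Rightarrow> grass \<Rightarrow> grass" where
  "move I g = parity_part 0 g + (-1) ^ sum_list (map par I) * parity_part 1 g"

definition form_mult :: "nat \<Rightarrow> nat \<Rightarrow> lform \<Rightarrow> lform \<Rightarrow> lform" where
  "form_mult n m \<omega> \<eta> J x =
     (\<Sum>k\<le>length J. \<Sum>I\<in>words n m k. \<Sum>I'\<in>words n m (length J - k).
        if sort (I @ I') = J then word_sign (I @ I') *\<^sub>R (move I' (\<omega> I x) * \<eta> I' x) else 0)"

definition form_fun :: "sfun \<Rightarrow> lform" where
  "form_fun f I = (if I = [] then f else 0)"

definition dx_word :: "idx list \<Rightarrow> lform" where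
  "dx_word I J = (if J = I then 1 else 0)"

definition d_fun :: "nat \<Rightarrow> nat \<Rightarrow> sfun \<Rightarrow> lform" where
  "d_fun n m f I = (case I of [A] \<Rightarrow> if A \<in> Idx n m then D (X A) f else 0 | _ \<Rightarrow> 0)"

text \<open>
  The differential on local \<open>k\<close>-forms: \<open>d(dx\<^sup>I \<omega>\<^sub>I) = (-1)\<^sup>k dx\<^sup>I d\<omega>\<^sub>I\<close>, by the product rule and
  \<open>d(dx\<^sup>A) = 0\<close>.
\<close>

definition d_local :: "nat \<Rightarrow> nat \<Rightarrow> nat \<Rightarrow> lform \<Rightarrow> lform" where
  "d_local n m k \<omega> = (\<Sum>I\<in>words n m k. (-1) ^ k * form_mult n m (dx_word I) (d_fun n m (\<omega> I)))"

definition form_pull :: "nat \<Rightarrow> nat \<Rightarrow> nat \<Rightarrow> (idx \<Rightarrow> sfun) \<Rightarrow> lform \<Rightarrow> lform" where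
  "form_pull n m k \<phi> \<omega> = (\<Sum>I\<in>words n m k.
     foldr (\<lambda>A. form_mult n m (d_fun n m (\<phi> A))) I (form_fun (pull n m \<phi> (\<omega> I))))"

definition Omega :: "nat \<Rightarrow> nat \<Rightarrow> ('a, 'i) supermfd \<Rightarrow> nat \<Rightarrow> ('i \<Rightarrow> lform) set" where
  "Omega n m M k = {\<omega>.
     (\<forall>i I. i \<notin> charts M \<or> I \<notin> words n m k \<longrightarrow> \<omega> i I = 0) \<and>
     (\<forall>i\<in>charts M. \<forall>I. \<omega> i I \<in> superfun (Xvars n m) (region n M i UNIV)) \<and>
     (\<forall>i\<in>charts M. \<forall>j\<in>charts M. \<forall>I. \<forall>x\<in>region n M j (cdom M i).
        \<omega> j I x = form_pull n m k (trans M i j) (\<omega> i) I x)}"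

definition d_form ::
  "nat \<Rightarrow> nat \<Rightarrow> ('a, 'i) supermfd \<Rightarrow> nat \<Rightarrow> ('i \<Rightarrow> lform) \<Rightarrow> 'i \<Rightarrow> lform" where
  "d_form n m M k \<omega> i I x =
     (if i \<in> charts M \<and> x \<in> region n M i UNIV then d_local n m k (\<omega> i) I x else 0)"


section \<open>Mixed forms\<close>

definition mvars :: "nat \<Rightarrow> nat \<Rightarrow> nat \<Rightarrow> nat \<Rightarrow> nat \<Rightarrow> nat \<Rightarrow> var set" where
  "mvars n m r s p q = Xvars n m \<union> (\<lambda>(A, K). P A K) ` (Idx n m \<times> Idx p q)
     \<union> (\<lambda>(F, K). W F K) ` (Idx r s \<times> Idx p q)"

text \<open>
  Over a superalgebra of functions the odd columns of the matrix \<open>p\<close> over \<open>w\<close> (resp. the odd rows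
  of \<open>w\<close>) are linearly independent iff their bodies are, and the bodies live in the odd-odd blocks.
\<close>

definition fiber_dom :: "nat \<Rightarrow> nat \<Rightarrow> nat \<Rightarrow> point set" where
  "fiber_dom m s q = {x.
     (\<forall>c. (\<forall>a<m. (\<Sum>k<q. x (P (Od a) (Od k)) * c k) = 0) \<and>
          (\<forall>f<s. (\<Sum>k<q. x (W (Od f) (Od k)) * c k) = 0) \<longrightarrow> (\<forall>k<q. c k = (0::real))) \<and>
     (\<forall>c. (\<forall>k<q. (\<Sum>f<s. c f * x (W (Od f) (Od k))) = 0) \<longrightarrow> (\<forall>f<s. c f = (0::real)))}"

definition mdom ::
  "nat \<Rightarrow> nat \<Rightarrow> ('a, 'i) supermfd \<Rightarrow> nat \<Rightarrow> nat \<Rightarrow> 'i \<Rightarrow> 'a set \<Rightarrow> point set" where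
  "mdom n m M s q i S = region n M i S \<inter> fiber_dom m s q"

text \<open>
  \<open>L(ph, wh) = L(p, w) Ber h\<close> and \<open>L(p + aw, gw) = L(p, w) Ber g\<close> are identities between functions of all
  the matrix entries, even and odd; they are imposed at the \<open>Lam N\<close>-points for every \<open>N\<close>.
\<close>

definition right_equivariant ::
  "nat \<Rightarrow> nat \<Rightarrow> nat \<Rightarrow> nat \<Rightarrow> nat \<Rightarrow> nat \<Rightarrow> point set \<Rightarrow> sfun \<Rightarrow> bool" where
  "right_equivariant n m r s p q U L \<longleftrightarrow>
     (\<forall>N. \<forall>z\<in>gpoints N (mvars n m r s p q) U. \<forall>h\<in>GL N p q.
        subst (mvars n m r s p q) L
          (\<lambda>v. case v of X A \<Rightarrow> z (X A)
             | P A K \<Rightarrow> \<Sum>J\<in>Idx p q. z (P A J) * h J K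
             | W F K \<Rightarrow> \<Sum>J\<in>Idx p q. z (W F J) * h J K)
        = subst (mvars n m r s p q) L z * Ber p q h)"

definition left_equivariant ::
  "nat \<Rightarrow> nat \<Rightarrow> nat \<Rightarrow> nat \<Rightarrow> nat \<Rightarrow> nat \<Rightarrow> point set \<Rightarrow> sfun \<Rightarrow> bool" where
  "left_equivariant n m r s p q U L \<longleftrightarrow>
     (\<forall>N. \<forall>z\<in>gpoints N (mvars n m r s p q) U. \<forall>g\<in>GL N r s.
      \<forall>a. even_matrix N (Idx n m) (Idx r s) a \<longrightarrow>
        subst (mvars n m r s p q) L
          (\<lambda>v. case v of X A \<Rightarrow> z (X A)
             | P A K \<Rightarrow> z (P A K) + (\<Sum>F\<in>Idx r s. a A F * z (W F K))
             | W F K \<Rightarrow> \<Sum>G\<in>Idx r s. g F G * z (W G K))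
        = subst (mvars n m r s p q) L z * Ber r s g)"

definition mixed_equations ::
  "nat \<Rightarrow> nat \<Rightarrow> nat \<Rightarrow> nat \<Rightarrow> nat \<Rightarrow> nat \<Rightarrow> point set \<Rightarrow> sfun \<Rightarrow> bool" where
  "mixed_equations n m r s p q U L \<longleftrightarrow> (\<forall>x\<in>U. \<forall>K\<in>Idx p q. \<forall>J\<in>Idx p q.
     (\<forall>A\<in>Idx n m. \<forall>B\<in>Idx n m.
        D (P A K) (D (P B J) L) x
        + (-1) ^ (par A * par B + (par A + par B) * par J) * D (P B K) (D (P A J) L) x = 0) \<and>
     (\<forall>A\<in>Idx n m. \<forall>F\<in>Idx r s.
        D (P A K) (D (W F J) L) x
        + (-1) ^ (par A * par F + (par A + par F) * par J) * D (W F K) (D (P A J) L) x = 0) \<and>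
     (\<forall>F\<in>Idx r s. \<forall>G\<in>Idx r s.
        D (W F K) (D (W G J) L) x
        + (-1) ^ (par F * par G + (par F + par G) * par J) * D (W G K) (D (W F J) L) x = 0))"

text \<open>
  Sections over \<open>M\<close>, by their coefficients \<open>L(x, p, w)\<close> in the charts.  If \<open>J\<close> is the matrix of the
  \<open>\<partial>x\<^sup>A/\<partial>x'\<^sup>B\<close> (row \<open>B\<close>, column \<open>A\<close>), where \<open>x\<close>, \<open>x'\<close> are the coordinates of charts \<open>i\<close>, \<open>j\<close>, then
  covectors transform by \<open>p' = J p\<close> and coefficients of elements of \<open>Vol TM = Ber T\<^sup>*M\<close> are
  multiplied by \<open>Ber J\<close>.
\<close>

definition Mixed :: "nat \<Rightarrow> nat \<Rightarrow> ('a, 'i) supermfd \<Rightarrow> nat \<Rightarrow> nat \<Rightarrow> nat \<Rightarrow> nat \<Rightarrow> ('i \<Rightarrow> sfun) set" where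
  "Mixed n m M r s p q = {L.
     (\<forall>i. i \<notin> charts M \<longrightarrow> L i = 0) \<and>
     (\<forall>i\<in>charts M.
        L i \<in> superfun (mvars n m r s p q) (mdom n m M s q i UNIV) \<and>
        right_equivariant n m r s p q (mdom n m M s q i UNIV) (L i) \<and>
        left_equivariant n m r s p q (mdom n m M s q i UNIV) (L i) \<and>
        mixed_equations n m r s p q (mdom n m M s q i UNIV) (L i)) \<and>
     (\<forall>i\<in>charts M. \<forall>j\<in>charts M. \<forall>N.
        \<forall>z\<in>gpoints N (mvars n m r s p q) (mdom n m M s q j (cdom M i)).
        let J = (\<lambda>B A. subst (Xvars n m) (D (X B) (trans M i j A)) z) in
        subst (mvars n m r s p q) (L j)
          (\<lambda>v. case v of P B K \<Rightarrow> \<Sum>A\<in>Idx n m. J B A * z (P A K) | _ \<Rightarrow> z v)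
        = subst (mvars n m r s p q) (L i)
            (\<lambda>v. case v of X A \<Rightarrow> subst (Xvars n m) (trans M i j A) z | _ \<Rightarrow> z v)
          * Ber n m J)}"

definition dbar_local :: "nat \<Rightarrow> nat \<Rightarrow> nat \<Rightarrow> nat \<Rightarrow> nat \<Rightarrow> sfun \<Rightarrow> sfun" where
  "dbar_local n m r p q L = (-1) ^ r * (\<Sum>A\<in>Idx n m. \<Sum>K\<in>Idx p q.
     coord (W (Ev r) K) * (-1) ^ (par A * par K) * D (X A) (D (P A K) L))"

text \<open>
  The operator \<open>e(\<alpha>)\<close>, \<open>\<alpha> = dx\<^sup>A \<alpha>\<^sub>A\<close>.  The formula with the sign \<open>(-1)\<^sup>\<alpha>\<^sup>A\<close> makes sense for \<open>\<alpha>\<close> of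
  parity \<open>\<epsilon>\<close>, for which \<open>\<alpha>\<^sub>A\<close> has parity \<open>\<epsilon> + A\<close>; in general it is applied to the even and the odd
  component of \<open>\<alpha>\<close>.
\<close>

definition e_local :: "nat \<Rightarrow> nat \<Rightarrow> nat \<Rightarrow> nat \<Rightarrow> nat \<Rightarrow> lform \<Rightarrow> sfun \<Rightarrow> sfun" where
  "e_local n m r p q \<alpha> L = (-1) ^ r * (\<Sum>\<epsilon>\<in>{0, 1}. \<Sum>A\<in>Idx n m. \<Sum>K\<in>Idx p q.
     (\<lambda>x. parity_part (\<epsilon> + par A) (\<alpha> [A] x)) * coord (W (Ev r) K) *
     (-1) ^ (\<epsilon> * par A) * D (P A K) L)"

text \<open>\<open>dx\<^sup>I L = e(dx\<^sup>A\<^sup>1) \<dots> e(dx\<^sup>A\<^sup>k) L\<close> for \<open>I = [A1, \<dots>, Ak]\<close> and \<open>L\<close> of type \<open>r|s\<close>.\<close>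

fun e_word :: "nat \<Rightarrow> nat \<Rightarrow> nat \<Rightarrow> nat \<Rightarrow> nat \<Rightarrow> idx list \<Rightarrow> sfun \<Rightarrow> sfun" where
  "e_word n m r p q [] L = L"
| "e_word n m r p q (A # I) L = e_local n m (r + length I) p q (dx_word [A]) (e_word n m r p q I L)"

text \<open>
  The module structure generated by multiplication by functions and the operators \<open>e(\<alpha>)\<close>; here
  \<open>\<omega> = \<Sum>\<^sub>I dx\<^sup>I \<omega>\<^sub>I\<close>.  For 1-forms this is \<open>e(\<alpha>) L\<close>, since \<open>e(dx\<^sup>A f) L = e(dx\<^sup>A) (f L)\<close>.
\<close>

definition act_local :: "nat \<Rightarrow> nat \<Rightarrow> nat \<Rightarrow> nat \<Rightarrow> nat \<Rightarrow> nat \<Rightarrow> lform \<Rightarrow> sfun \<Rightarrow> sfun" where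
  "act_local n m k r p q \<omega> L = (\<Sum>I\<in>words n m k. e_word n m r p q I (\<omega> I * L))"

definition dbar :: "nat \<Rightarrow> nat \<Rightarrow> ('a, 'i) supermfd \<Rightarrow> nat \<Rightarrow> nat \<Rightarrow> nat \<Rightarrow> nat \<Rightarrow>
    ('i \<Rightarrow> sfun) \<Rightarrow> 'i \<Rightarrow> sfun" where
  "dbar n m M r s p q L i x =
     (if i \<in> charts M \<and> x \<in> mdom n m M s q i UNIV then dbar_local n m r p q (L i) x else 0)"

definition act :: "nat \<Rightarrow> nat \<Rightarrow> ('a, 'i) supermfd \<Rightarrow> nat \<Rightarrow> nat \<Rightarrow> nat \<Rightarrow> nat \<Rightarrow> nat \<Rightarrow>
    ('i \<Rightarrow> lform) \<Rightarrow> ('i \<Rightarrow> sfun) \<Rightarrow> 'i \<Rightarrow> sfun" where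
  "act n m M k r s p q \<omega> L i x =
     (if i \<in> charts M \<and> x \<in> mdom n m M s q i UNIV then act_local n m k r p q (\<omega> i) (L i) x else 0)"

end

(*
  Everything is local.  Write e_A for e(dx^A).  The odd and even partial derivatives are graded
  derivations that graded-commute on smooth superfunctions, so dbar = sum_A (-1)^A d_A e_A and
  d_A e_B = (-1)^(AB) e_B d_A.  The mixed equations in p give e_A e_B = -(-1)^(AB) e_B e_A,
  and they are inherited by e_A L and f L; hence dbar e_B = - e_B dbar.  Together with
  dbar (f L) = sum_A e_A (d_A f L) + f dbar L, for f depending on x only, this gives the formula for
  dx^I f by moving dbar through the e_A, after sorting the words I A.
*)
theory Submission
  imports Defs
begin

section \<open>Graded derivations of the Grassmann algebra\<close>

text \<open>The coefficients of the forms need not be homogeneous, so a sign such as (-1)^f has no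
  meaning for them. All graded rules are therefore written with the parity automorphism:
  \<open>flip e\<close> multiplies a monomial of degree d by (-1)^(e d). On homogeneous factors this
  gives the usual signs, and flips compose by adding their exponents. The analytic obstacle is that
  \<open>smooth\<close> speaks only of iterated partial derivatives, continuous in the product
  topology on all variables, infinitely many of them. Symmetry of second derivatives is recovered in
  coordinate planes. This requires the domain of a mixed form to be open in that topology; for the
  linear independence conditions, openness comes from compactness of a unit sphere. The words I A
  that appear when dbar meets a coefficient need not be normal after sorting. A repeated even index
  kills the term because e_A e_A = 0 for even A, in agreement with the value 0 of
  \<open>word_sign\<close>.\<close>

definition flip :: "nat \<Rightarrow> grass \<Rightarrow> grass" where
  "flip e g = mk_grass (\<lambda>S. (-1) ^ (e * card S) * coef g S)"

lemma coef_flip: "coef (flip e g) S = (-1) ^ (e * card S) * coef g S"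
  by (simp add: flip_def coef_mk_grass coef_infinite)

text \<open>Each term of the coefficient at U splits U into two disjoint parts, whose cardinalities
  add.\<close>

lemma flip_mult: "flip e (g * h) = flip e g * flip e h"
proof (rule grass_eqI)
  fix U :: "nat set" assume U: "finite U"
  show "coef (flip e (g * h)) U = coef (flip e g * flip e h) U"
    unfolding coef_mult coef_flip sum_distrib_left
  proof (rule sum.cong)
    fix S assume "S \<in> Pow U"
    then have "card U = card S + card (U - S)"
      using U by (metis PowD card_Diff_subset card_mono finite_subset le_add_diff_inverse)
    then show "(-1) ^ (e * card U) * (gsign S (U - S) * coef g S * coef h (U - S)) =
      gsign S (U - S) * ((-1) ^ (e * card S) * coef g S) * ((-1) ^ (e * card (U - S)) * coef h (U - S))"
      by (simp add: add_mult_distrib2 power_add)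
  qed simp
qed

lemma flip_add: "flip e (g + h) = flip e g + flip e h"
  by (rule grass_eqI) (simp add: coef_flip coef_simps algebra_simps)

lemma flip_flip: "flip e (flip e' g) = flip (e + e') g"
  by (rule grass_eqI) (simp add: coef_flip add_mult_distrib power_add)

lemma flip_cong: "even e \<longleftrightarrow> even e' \<Longrightarrow> flip e g = flip e' g"
  by (rule grass_eqI) (simp add: coef_flip uminus_power_if)

lemma flip_even: "even e \<Longrightarrow> flip e g = g"
  by (rule grass_eqI) (simp add: coef_flip uminus_power_if)

lemma flip_of_real: "flip e (of_real c) = of_real c"
  by (rule grass_eqI) (simp add: coef_flip of_real_def coef_simps)

lemma flip_zero: "flip e 0 = 0"
  using flip_of_real[of e 0] by simp

lemma coef_gen: "coef (gen i) S = (if S = {i} then 1 else 0)"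
  by (auto simp: gen_def coef_mk_grass)

lemma flip_gen: "flip e (gen i) = (-1) ^ e *\<^sub>R gen i"
  by (rule grass_eqI) (simp add: coef_flip coef_gen coef_simps)

text \<open>The two factors count the elements of S below i and above i; as i is not in S, every
  element is counted once.\<close>

lemma gsign_gsign:
  assumes "finite S" "i \<notin> S"
  shows "gsign {i} S * gsign S {i} = (-1) ^ card S"
proof -
  have "{(a, b). a \<in> {i} \<and> b \<in> S \<and> b < a} = Pair i ` {b\<in>S. b < i}"
    "{(a, b). a \<in> S \<and> b \<in> {i} \<and> b < a} = (\<lambda>a. (a, i)) ` {a\<in>S. i < a}" by auto
  then have "gsign {i} S * gsign S {i} = (-1) ^ (card {b\<in>S. b < i} + card {a\<in>S. i < a})"
    unfolding gsign_def by (simp add: card_image inj_on_def power_add)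
  also have "card {b\<in>S. b < i} + card {a\<in>S. i < a} = card ({b\<in>S. b < i} \<union> {a\<in>S. i < a})"
    using assms by (subst card_Un_disjoint) auto
  also have "{b\<in>S. b < i} \<union> {a\<in>S. i < a} = S"
    using assms by (auto, metis linorder_neqE_nat)
  finally show ?thesis .
qed

lemma gsign_sq: "gsign S T * gsign S T = 1"
  by (simp add: gsign_def flip: power_add mult_2)

lemma coef_gen_mult:
  "coef (gen i * g) U = (if i \<in> U then gsign {i} (U - {i}) * coef g (U - {i}) else 0)"
proof (cases "finite U")
  case True
  have "coef (gen i * g) U = (\<Sum>S\<in>Pow U. if S = {i} then gsign {i} (U - {i}) * coef g (U - {i}) else 0)"
    unfolding coef_mult by (rule sum.cong) (auto simp: coef_gen)
  then show ?thesis using True by simp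
qed (simp add: coef_infinite)

lemma coef_mult_gen:
  "coef (g * gen i) U = (if i \<in> U then gsign (U - {i}) {i} * coef g (U - {i}) else 0)"
proof (cases "finite U")
  case True
  have "coef (g * gen i) U =
      (\<Sum>S\<in>Pow U. if S = U - {i} then (if i \<in> U then gsign (U - {i}) {i} * coef g (U - {i}) else 0) else 0)"
    unfolding coef_mult
  proof (rule sum.cong)
    fix S assume S: "S \<in> Pow U"
    show "gsign S (U - S) * coef g S * coef (gen i) (U - S) =
       (if S = U - {i} then (if i \<in> U then gsign (U - {i}) {i} * coef g (U - {i}) else 0) else 0)"
    proof (cases "U - S = {i}")
      case True
      then have "S = U - {i}" "i \<in> U" using S by auto
      then show ?thesis using True by (simp add: coef_gen)
    next
      case False
      then have "\<not> (S = U - {i} \<and> i \<in> U)" by auto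
      then show ?thesis using False by (metis (lifting) coef_gen mult_zero_right)
    qed
  qed simp
  then show ?thesis using True by auto
qed (simp add: coef_infinite)

lemma gen_mult_commute: "gen i * g = flip 1 g * gen i"
proof (rule grass_eqI)
  fix U :: "nat set" assume U: "finite U"
  \<comment> \<open>A sign squares to 1, so inserting the reverse sign twice makes
    \<open>gsign_gsign\<close> applicable and leaves the factor (-1)^d of
    \<open>flip 1\<close>.\<close>
  have "gsign {i} (U - {i}) = gsign {i} (U - {i}) * gsign (U - {i}) {i} * gsign (U - {i}) {i}"
    by (simp add: gsign_sq mult.assoc)
  also have "\<dots> = (-1) ^ card (U - {i}) * gsign (U - {i}) {i}"
    using U by (subst gsign_gsign) auto
  finally have "gsign {i} (U - {i}) = (-1) ^ card (U - {i}) * gsign (U - {i}) {i}" .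
  then show "coef (gen i * g) U = coef (flip 1 g * gen i) U"
    by (simp add: coef_gen_mult coef_mult_gen coef_flip)
qed

section \<open>The left derivative by an odd generator\<close>

lemma coef_left_deriv:
  "coef (left_deriv i g) S = (if i \<in> S then 0 else gsign {i} S * coef g (insert i S))"
  by (simp add: left_deriv_def coef_mk_grass coef_infinite)

definition free_of :: "nat \<Rightarrow> grass \<Rightarrow> bool" where
  "free_of i g \<longleftrightarrow> (\<forall>S. i \<in> S \<longrightarrow> coef g S = 0)"

lemma free_of_mult: "free_of i g \<Longrightarrow> free_of i h \<Longrightarrow> free_of i (g * h)"
  unfolding free_of_def coef_mult
  by (intro allI impI sum.neutral ballI) (metis DiffI PowD mult_eq_0_iff)

lemma free_of_add: "free_of i g \<Longrightarrow> free_of i h \<Longrightarrow> free_of i (g + h)"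
  by (simp add: free_of_def coef_simps)

lemma free_of_flip: "free_of i g \<Longrightarrow> free_of i (flip e g)"
  by (simp add: free_of_def coef_flip)

lemma free_of_left_deriv: "free_of i (left_deriv i g)"
  by (simp add: free_of_def coef_left_deriv)

lemma left_deriv_add: "left_deriv i (g + h) = left_deriv i g + left_deriv i h"
  by (rule grass_eqI) (simp add: coef_left_deriv coef_simps algebra_simps)

lemma left_deriv_free: "free_of i g \<Longrightarrow> left_deriv i g = 0"
  by (rule grass_eqI) (simp add: coef_left_deriv coef_simps free_of_def)

lemma left_deriv_gen_mult: "free_of i g \<Longrightarrow> left_deriv i (gen i * g) = g"
  by (rule grass_eqI)
    (auto simp: coef_left_deriv coef_gen_mult free_of_def gsign_sq mult.assoc[symmetric])

lemma left_deriv_decomp: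
  obtains g0 where "free_of i g0" "g = g0 + gen i * left_deriv i g"
proof
  show "free_of i (g - gen i * left_deriv i g)"
    by (auto simp: free_of_def coef_simps coef_gen_mult coef_left_deriv gsign_sq insert_absorb
        mult.assoc[symmetric])
qed simp

lemma gen_gen: "gen i * gen i = 0"
  by (rule grass_eqI) (auto simp: coef_gen_mult coef_gen coef_simps)

text \<open>Both factors are split as \<open>g\<^sub>0 + \<xi>\<^sub>i g\<^sub>1\<close> with \<open>g\<^sub>0\<close>, \<open>g\<^sub>1\<close> free of \<open>\<xi>\<^sub>i\<close>.\<close>

lemma left_deriv_mult:
  "left_deriv i (g * h) = left_deriv i g * h + flip 1 g * left_deriv i h"
proof -
  obtain g0 where g0: "free_of i g0" "g = g0 + gen i * left_deriv i g"
    by (rule left_deriv_decomp)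
  obtain h0 where h0: "free_of i h0" "h = h0 + gen i * left_deriv i h"
    by (rule left_deriv_decomp)
  define g1 h1 where "g1 = left_deriv i g" and "h1 = left_deriv i h"
  have fr: "free_of i g1" "free_of i h1" by (simp_all add: g1_def h1_def free_of_left_deriv)
  have g: "g = g0 + gen i * g1" and h: "h = h0 + gen i * h1"
    using g0 h0 by (simp_all add: g1_def h1_def)
  have c: "g' * gen i = gen i * flip 1 g'" for g'
    by (simp add: gen_mult_commute flip_flip flip_even)
  have c': "g' * (gen i * h') = gen i * (flip 1 g' * h')" for g' h'
    by (simp add: c mult.assoc[symmetric])
  have gg: "gen i * (gen i * g') = 0" for g'
    by (simp add: gen_gen mult.assoc[symmetric])
  have "g * h = g0 * h0 + gen i * (g1 * h0 + flip 1 g0 * h1)"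
    unfolding g h using c'[of g0 h1] c'[of g1 h1] gg[of "flip 1 g1 * h1"]
    by (simp add: distrib_left distrib_right mult.assoc)
  then have "left_deriv i (g * h) = g1 * h0 + flip 1 g0 * h1"
    using fr g0 h0
    by (simp add: left_deriv_add left_deriv_free left_deriv_gen_mult free_of_mult free_of_add free_of_flip)
  also have "\<dots> = g1 * h + flip 1 g * h1"
  proof -
    \<comment> \<open>The flip changes the sign of \<xi>_i, hence the plus sign. The extra term
      \<xi>_i (flip 1 g1) h1 equals g1 \<xi>_i h1, which completes g1 h0 to g1 h.\<close>
    have f: "flip 1 g0 = flip 1 g + gen i * flip 1 g1"
      unfolding g by (simp add: flip_add flip_mult flip_gen)
    show ?thesis
      unfolding f using c'[of g1 h1]
      by (subst h) (simp add: algebra_simps)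
  qed
  finally show ?thesis by (simp add: g1_def h1_def)
qed

text \<open>The signs relative to S are the same in both orders. The only difference is the mutual
  sign of i and j: of the two orders exactly one is an inversion.\<close>

lemma left_deriv_left_deriv: "left_deriv i (left_deriv j g) = - left_deriv j (left_deriv i g)"
proof (rule grass_eqI)
  fix S :: "nat set" assume S: "finite S"
  have sw: "gsign {i} {j} = - gsign {j} {i}" if "i \<noteq> j"
  proof -
    have "{(a, b). a \<in> {i} \<and> b \<in> {j} \<and> b < a} = (if j < i then {(i, j)} else {})"
      "{(a, b). a \<in> {j} \<and> b \<in> {i} \<and> b < a} = (if i < j then {(j, i)} else {})" by auto
    then show ?thesis using that by (auto simp: gsign_def)
  qed
  have ins: "gsign {a} (insert b S) = gsign {a} {b} * gsign {a} S" if "b \<notin> S" for a b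
    using gsign_Un_right[of "{a}" "{b}" S] that S by simp
  show "coef (left_deriv i (left_deriv j g)) S = coef (- left_deriv j (left_deriv i g)) S"
  proof (cases "i = j \<or> i \<in> S \<or> j \<in> S")
    case True
    then show ?thesis by (auto simp: coef_simps coef_left_deriv)
  next
    case False
    have "coef (left_deriv i (left_deriv j g)) S =
        gsign {j} {i} * (gsign {i} S * gsign {j} S * coef g (insert i (insert j S)))"
      using False by (simp add: coef_left_deriv ins insert_commute)
    moreover have "coef (left_deriv j (left_deriv i g)) S =
        gsign {i} {j} * (gsign {i} S * gsign {j} S * coef g (insert i (insert j S)))"
      using False by (simp add: coef_left_deriv ins)
    ultimately show ?thesis using sw False by (simp add: coef_simps)
  qed
qed

lemma left_deriv_flip: "left_deriv i (flip e g) = (-1) ^ e *\<^sub>R flip e (left_deriv i g)"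
proof (rule grass_eqI)
  fix S :: "nat set" assume S: "finite S"
  show "coef (left_deriv i (flip e g)) S = coef ((-1) ^ e *\<^sub>R flip e (left_deriv i g)) S"
    using S by (cases "i \<in> S") (simp_all add: coef_left_deriv coef_flip coef_simps power_add)
qed

section \<open>Smooth functions on an open set\<close>

text \<open>The second difference over a square of side h is evaluated by two mean value theorems,
  in either order of the variables. This yields a value of \<open>F12\<close> and a value of
  \<open>F21\<close> at points of the square that coincide, which contradicts continuity at the
  corner if the limits differ.\<close>

lemma clairaut_real:
  fixes F :: "real \<Rightarrow> real \<Rightarrow> real"
  assumes e: "e > 0"
    and F1: "\<And>s t. \<bar>s - a\<bar> < e \<Longrightarrow> \<bar>t - b\<bar> < e \<Longrightarrow> ((\<lambda>s. F s t) has_field_derivative F1 s t) (at s)"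
    and F2: "\<And>s t. \<bar>s - a\<bar> < e \<Longrightarrow> \<bar>t - b\<bar> < e \<Longrightarrow> ((\<lambda>t. F s t) has_field_derivative F2 s t) (at t)"
    and F12: "\<And>s t. \<bar>s - a\<bar> < e \<Longrightarrow> \<bar>t - b\<bar> < e \<Longrightarrow> ((\<lambda>t. F1 s t) has_field_derivative F12 s t) (at t)"
    and F21: "\<And>s t. \<bar>s - a\<bar> < e \<Longrightarrow> \<bar>t - b\<bar> < e \<Longrightarrow> ((\<lambda>s. F2 s t) has_field_derivative F21 s t) (at s)"
    and c12: "isCont (\<lambda>(s, t). F12 s t) (a, b)" and c21: "isCont (\<lambda>(s, t). F21 s t) (a, b)"
  shows "F12 a b = F21 a b"
proof (rule ccontr)
  assume ne: "F12 a b \<noteq> F21 a b"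
  \<comment> \<open>Half the gap: values closer than d to the two different limits cannot be
    equal.\<close>
  define d where "d = \<bar>F12 a b - F21 a b\<bar> / 2"
  have d: "d > 0" using ne by (simp add: d_def)
  obtain r1 r2 where r12: "r1 > 0" "r2 > 0"
    and "\<And>z. dist z (a, b) < r1 \<Longrightarrow> dist (case z of (s, t) \<Rightarrow> F12 s t) (F12 a b) < d"
    and "\<And>z. dist z (a, b) < r2 \<Longrightarrow> dist (case z of (s, t) \<Rightarrow> F21 s t) (F21 a b) < d"
    using c12 c21 d unfolding continuous_at_eps_delta by (metis case_prod_conv)
  then have close: "\<bar>F12 s t - F12 a b\<bar> < d \<and> \<bar>F21 s t - F21 a b\<bar> < d"
    if "dist (s, t) (a, b) < min r1 r2" for s t
    using that by (fastforce simp: dist_real_def)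
  define r where "r = min r1 r2"
  have r: "r > 0" using r12 by (simp add: r_def)
  note close = close[folded r_def]
  \<comment> \<open>Two bounds are wanted: h < e keeps the closed square where the derivatives
    exist, and 2 h < r keeps it in the ball, by comparison with the l1 distance.\<close>
  define h where "h = min e r / 3"
  have h: "h > 0" "h < e" "2 * h < r" using e r by (auto simp: h_def)
  have near: "dist (s, t) (a, b) < r" if "a < s" "s < a + h" "b < t" "t < b + h" for s t
  proof -
    have "dist (s, t) (a, b) \<le> \<bar>s - a\<bar> + \<bar>t - b\<bar>"
      by (simp add: dist_Pair_Pair dist_real_def sqrt_sum_squares_le_sum_abs)
    then show ?thesis using that h by linarith
  qed
  let ?\<Delta> = "F (a + h) (b + h) - F (a + h) b - (F a (b + h) - F a b)"
  obtain s where s: "a < s" "s < a + h" "?\<Delta> = h * (F1 s (b + h) - F1 s b)"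
  proof -
    have "\<exists>z>a. z < a + h \<and> (F (a + h) (b + h) - F (a + h) b) - (F a (b + h) - F a b)
        = (a + h - a) * (F1 z (b + h) - F1 z b)"
      using h by (intro MVT2) (auto intro!: derivative_intros F1)
    then show ?thesis using that by auto
  qed
  obtain t where t: "b < t" "t < b + h" "F1 s (b + h) - F1 s b = h * F12 s t"
  proof -
    have "\<exists>z>b. z < b + h \<and> F1 s (b + h) - F1 s b = (b + h - b) * F12 s z"
      using h s by (intro MVT2) (auto intro!: F12)
    then show ?thesis using that by auto
  qed
  obtain t' where t': "b < t'" "t' < b + h" "?\<Delta> = h * (F2 (a + h) t' - F2 a t')"
  proof -
    have "\<exists>z>b. z < b + h \<and> (F (a + h) (b + h) - F a (b + h)) - (F (a + h) b - F a b)
        = (b + h - b) * (F2 (a + h) z - F2 a z)"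
      using h by (intro MVT2) (auto intro!: derivative_intros F2)
    then show ?thesis using that by (auto simp: algebra_simps)
  qed
  obtain s' where s': "a < s'" "s' < a + h" "F2 (a + h) t' - F2 a t' = h * F21 s' t'"
  proof -
    have "\<exists>z>a. z < a + h \<and> F2 (a + h) t' - F2 a t' = (a + h - a) * F21 z t'"
      using h t' by (intro MVT2) (auto intro!: F21)
    then show ?thesis using that by auto
  qed
  have "h * (h * F12 s t) = h * (h * F21 s' t')"
    using s(3) t'(3) unfolding t(3) s'(3) by linarith
  then have "F12 s t = F21 s' t'" using h by simp
  moreover have "\<bar>F12 s t - F12 a b\<bar> < d" "\<bar>F21 s' t' - F21 a b\<bar> < d"
    using close near s t s' t' by blast+
  ultimately show False unfolding d_def by (simp add: field_simps abs_if split: if_splits)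
qed

text \<open>Serves to pull an open set of points back to an open set of the (u, v)-plane.\<close>

lemma continuous_on_fun_upd2:
  "continuous_on A (\<lambda>z. (x(u := fst z, v := snd z)) :: 'a \<Rightarrow> 'b::topological_space)"
proof (rule continuous_on_coordinatewise_then_product)
  fix i
  show "continuous_on A (\<lambda>z. (x(u := fst z, v := snd z)) i)"
    by (cases "i = v"; cases "i = u") (auto intro!: continuous_intros)
qed

lemma continuous_on_fun_upd1:
  "continuous_on A (\<lambda>t. (x(v := t)) :: 'a \<Rightarrow> 'b::topological_space)"
proof (rule continuous_on_coordinatewise_then_product)
  fix i
  show "continuous_on A (\<lambda>t. (x(v := t)) i)"
    by (cases "i = v") auto
qed

lemma iter_pd_simps [simp]: "iter_pd [] g = g" "iter_pd (v # vs) g = pd v (iter_pd vs g)"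
  by (simp_all add: iter_pd_def)

lemma iter_pd_snoc: "iter_pd (vs @ [v]) g = iter_pd vs (pd v g)"
  by (simp add: iter_pd_def)

lemma smooth_continuous: "smooth U g \<Longrightarrow> continuous_on U g"
  unfolding smooth_def by (metis iter_pd_simps(1))

lemma smooth_pd: "smooth U g \<Longrightarrow> smooth U (pd v g)"
  unfolding smooth_def by (metis iter_pd_snoc)

lemma smooth_has_deriv:
  assumes "smooth U g" "x \<in> U"
  shows "((\<lambda>t. g (x(v := t))) has_field_derivative pd v g x) (at (x v))"
proof -
  have "(\<lambda>t. iter_pd [] g (x(v := t))) differentiable at (x v)"
    using assms unfolding smooth_def by blast
  then show ?thesis
    by (simp add: pd_def DERIV_deriv_iff_real_differentiable)
qed

lemma smooth_subset: "smooth U g \<Longrightarrow> V \<subseteq> U \<Longrightarrow> smooth V g"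
  unfolding smooth_def by (meson continuous_on_subset subsetD)

lemma pd_eqI: "((\<lambda>t. g (x(v := t))) has_field_derivative d) (at (x v)) \<Longrightarrow> pd v g x = d"
  by (simp add: pd_def DERIV_imp_deriv)

text \<open>Openness in the product topology keeps short coordinate segments and squares around a
  point inside \<open>U\<close>, so that derivatives at points of \<open>U\<close> depend only on
  the values there.\<close>

locale superdomain =
  fixes U :: "point set"
  assumes open_U: "open U"
begin

lemma line_in_U:
  assumes "x \<in> U"
  shows "eventually (\<lambda>t. x(v := t) \<in> U) (nhds (x v))"
proof -
  have "open ((\<lambda>t. x(v := t)) -` U)"
    using open_U continuous_on_fun_upd1[of UNIV x v] by (simp add: open_vimage)
  then show ?thesis using assms by (auto simp: eventually_nhds intro!: exI[of _ "(\<lambda>t. x(v := t)) -` U"])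
qed

lemma pd_cong:
  assumes "\<And>y. y \<in> U \<Longrightarrow> f y = g y" "x \<in> U"
  shows "pd v f x = pd v g x"
  unfolding pd_def
proof (rule deriv_cong_ev)
  show "eventually (\<lambda>t. f (x(v := t)) = g (x(v := t))) (nhds (x v))"
    using line_in_U[OF assms(2), of v] by eventually_elim (rule assms(1))
qed simp

text \<open>
  Closure of the smooth functions under sums and products: being stable under \<open>pd\<close>, it consists of
  smooth functions, which avoids a Leibniz formula for iterated derivatives.
\<close>

inductive smooth_hull :: "(point \<Rightarrow> real) \<Rightarrow> bool" where
  smooth_hull_smooth: "smooth U g \<Longrightarrow> smooth_hull g"
| smooth_hull_const: "smooth_hull (\<lambda>_. c)"
| smooth_hull_coord: "smooth_hull (\<lambda>x. x v)"
| smooth_hull_add: "smooth_hull g \<Longrightarrow> smooth_hull h \<Longrightarrow> smooth_hull (\<lambda>x. g x + h x)"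
| smooth_hull_mult: "smooth_hull g \<Longrightarrow> smooth_hull h \<Longrightarrow> smooth_hull (\<lambda>x. g x * h x)"
| smooth_hull_cong: "smooth_hull g \<Longrightarrow> (\<And>x. x \<in> U \<Longrightarrow> f x = g x) \<Longrightarrow> smooth_hull f"

text \<open>The sum and product rules express each partial derivative through the constructors
  again, but only on \<open>U\<close>; \<open>smooth_hull_cong\<close> absorbs the unknown values
  elsewhere. The three claims go into one induction because the derivative formulas rest on
  differentiability of the parts.\<close>

lemma smooth_hull_derivs:
  assumes "smooth_hull g"
  shows "continuous_on U g \<and>
    (\<forall>v. \<forall>x\<in>U. ((\<lambda>t. g (x(v := t))) has_field_derivative pd v g x) (at (x v))) \<and> (\<forall>v. smooth_hull (pd v g))"
  using assms
proof induction
  case (smooth_hull_smooth g)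
  then show ?case
    by (intro conjI allI ballI smooth_continuous smooth_has_deriv smooth_pd smooth_hull.smooth_hull_smooth)
next
  case (smooth_hull_const c)
  have "((\<lambda>t. c) has_field_derivative pd v (\<lambda>_. c) x) (at (x v))" for v x
    by (simp add: pd_def)
  moreover have "pd v (\<lambda>_. c) = (\<lambda>_. 0)" for v by (simp add: pd_def fun_eq_iff)
  ultimately show ?case by (auto intro: smooth_hull.smooth_hull_const)
next
  case (smooth_hull_coord u)
  have d: "((\<lambda>t. (x(v := t)) u) has_field_derivative (if u = v then 1 else 0)) (at (x v))"
    for x :: point and v by auto
  then have "pd v (\<lambda>x. x u) = (\<lambda>_. if u = v then 1 else 0)" for v
    by (intro ext pd_eqI)
  then show ?case
    using d continuous_on_subset[OF continuous_on_product_coordinates subset_UNIV]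
    by (auto intro: smooth_hull.smooth_hull_const)
next
  case (smooth_hull_add g h)
  have d: "((\<lambda>t. g (x(v := t)) + h (x(v := t))) has_field_derivative pd v g x + pd v h x) (at (x v))"
    if "x \<in> U" for v x using smooth_hull_add.IH that by (intro DERIV_add) blast+
  then have e: "pd v (\<lambda>x. g x + h x) x = pd v g x + pd v h x" if "x \<in> U" for v x
    using that by (intro pd_eqI)
  have "smooth_hull (pd v (\<lambda>x. g x + h x))" for v
    using smooth_hull_add.IH by (intro smooth_hull.smooth_hull_cong[OF smooth_hull.smooth_hull_add[of "pd v g" "pd v h"] e]) auto
  moreover have "continuous_on U (\<lambda>x. g x + h x)"
    using smooth_hull_add.IH by (blast intro: continuous_intros)
  moreover have "((\<lambda>t. g (x(v := t)) + h (x(v := t))) has_field_derivative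
      pd v (\<lambda>x. g x + h x) x) (at (x v))" if "x \<in> U" for v x
    using d[OF that] by (simp only: e[OF that])
  ultimately show ?case by blast
next
  case (smooth_hull_mult g h)
  have d: "((\<lambda>t. g (x(v := t)) * h (x(v := t))) has_field_derivative pd v g x * h x + g x * pd v h x) (at (x v))"
    if "x \<in> U" for v x
  proof -
    have "((\<lambda>t. g (x(v := t))) has_field_derivative pd v g x) (at (x v))"
      "((\<lambda>t. h (x(v := t))) has_field_derivative pd v h x) (at (x v))"
      using smooth_hull_mult.IH that by blast+
    from DERIV_mult[OF this] show ?thesis by (simp add: mult.commute add.commute)
  qed
  then have e: "pd v (\<lambda>x. g x * h x) x = pd v g x * h x + g x * pd v h x" if "x \<in> U" for v x
    using that by (intro pd_eqI)
  have "smooth_hull (pd v (\<lambda>x. g x * h x))" for v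
    using smooth_hull_mult by (intro smooth_hull.smooth_hull_cong[OF smooth_hull.smooth_hull_add[OF smooth_hull.smooth_hull_mult[of "pd v g" h] smooth_hull.smooth_hull_mult[of g "pd v h"]] e]) auto
  moreover have "continuous_on U (\<lambda>x. g x * h x)"
    using smooth_hull_mult.IH by (blast intro: continuous_intros)
  moreover have "((\<lambda>t. g (x(v := t)) * h (x(v := t))) has_field_derivative
      pd v (\<lambda>x. g x * h x) x) (at (x v))" if "x \<in> U" for v x
    using d[OF that] by (simp only: e[OF that])
  ultimately show ?case by blast
next
  case (smooth_hull_cong g f)
  have e: "pd v f x = pd v g x" if "x \<in> U" for v x using pd_cong smooth_hull_cong.hyps that by blast
  have "((\<lambda>t. f (x(v := t))) has_field_derivative pd v f x) (at (x v))" if "x \<in> U" for v x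
  proof -
    have "eventually (\<lambda>t. f (x(v := t)) = g (x(v := t))) (nhds (x v))"
      using line_in_U[OF that] by eventually_elim (rule smooth_hull_cong.hyps)
    moreover have "((\<lambda>t. g (x(v := t))) has_field_derivative pd v g x) (at (x v))"
      using smooth_hull_cong.IH that by blast
    ultimately show ?thesis unfolding e[OF that] by (subst DERIV_cong_ev[OF refl _ refl])
  qed
  moreover have "smooth_hull (pd v f)" for v
    using smooth_hull_cong.IH e by (blast intro: smooth_hull.smooth_hull_cong)
  moreover have "continuous_on U f"
    using smooth_hull_cong by (metis continuous_on_cong)
  ultimately show ?case by blast
qed

lemma smooth_iff_smooth_hull: "smooth U g \<longleftrightarrow> smooth_hull g"
proof
  assume g: "smooth_hull g"
  have *: "smooth_hull (iter_pd vs g)" for vs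
    using g smooth_hull_derivs by (induction vs) auto
  show "smooth U g"
    unfolding smooth_def
    using smooth_hull_derivs[OF *] by (auto simp: real_differentiable_def)
qed (rule smooth_hull_smooth)

lemma smooth_const: "smooth U (\<lambda>_. c)"
  and smooth_coord: "smooth U (\<lambda>x. x v)"
  and smooth_add: "smooth U f \<Longrightarrow> smooth U g \<Longrightarrow> smooth U (\<lambda>x. f x + g x)"
  and smooth_mult: "smooth U f \<Longrightarrow> smooth U g \<Longrightarrow> smooth U (\<lambda>x. f x * g x)"
  and smooth_cong: "smooth U g \<Longrightarrow> (\<And>x. x \<in> U \<Longrightarrow> f x = g x) \<Longrightarrow> smooth U f"
  unfolding smooth_iff_smooth_hull by (auto intro: smooth_hull.intros)

lemma smooth_sum: "(\<And>i. i \<in> I \<Longrightarrow> smooth U (f i)) \<Longrightarrow> smooth U (\<lambda>x. \<Sum>i\<in>I. f i x)"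
  by (induction I rule: infinite_finite_induct) (auto intro: smooth_const smooth_add)

lemma pd_const: "pd v (\<lambda>_. c) x = 0"
  by (simp add: pd_def)

lemma pd_coord: "pd v (\<lambda>x. x u) x = (if u = v then 1 else 0)"
  by (rule pd_eqI) auto

lemma pd_add: "smooth U f \<Longrightarrow> smooth U g \<Longrightarrow> x \<in> U \<Longrightarrow> pd v (\<lambda>x. f x + g x) x = pd v f x + pd v g x"
  by (intro pd_eqI DERIV_add smooth_has_deriv)

lemma pd_mult:
  assumes "smooth U f" "smooth U g" "x \<in> U"
  shows "pd v (\<lambda>x. f x * g x) x = pd v f x * g x + f x * pd v g x"
  using DERIV_mult[OF smooth_has_deriv[OF assms(1,3)] smooth_has_deriv[OF assms(2,3)]]
  by (intro pd_eqI) (auto simp: mult.commute)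

lemma pd_sum:
  assumes "\<And>i. i \<in> I \<Longrightarrow> smooth U (f i)" "x \<in> U"
  shows "pd v (\<lambda>x. \<Sum>i\<in>I. f i x) x = (\<Sum>i\<in>I. pd v (f i) x)"
  using assms(1)
  by (induction I rule: infinite_finite_induct)
    (auto simp: pd_const assms(2) pd_add smooth_sum)

lemma pd_commute:
  assumes g: "smooth U g" and x: "x \<in> U"
  shows "pd u (pd v g) x = pd v (pd u g) x"
proof (cases "u = v")
  case False
  let ?\<phi> = "\<lambda>z. x(u := fst z, v := snd z)"
  have "open (?\<phi> -` U)"
    by (rule open_vimage[OF open_U continuous_on_fun_upd2])
  moreover have "(x u, x v) \<in> ?\<phi> -` U" using x by simp
  ultimately obtain r where r: "r > 0" "ball (x u, x v) r \<subseteq> ?\<phi> -` U"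
    by (meson open_contains_ball)
  \<comment> \<open>With half the radius in each direction the l1 distance, hence the Euclidean one,
    stays below r.\<close>
  have inU: "x(u := s, v := t) \<in> U" if "\<bar>s - x u\<bar> < r / 2" "\<bar>t - x v\<bar> < r / 2" for s t
  proof -
    have "dist (x u, x v) (s, t) \<le> \<bar>x u - s\<bar> + \<bar>x v - t\<bar>"
      by (simp add: dist_Pair_Pair dist_real_def sqrt_sum_squares_le_sum_abs)
    then have "(s, t) \<in> ball (x u, x v) r" unfolding mem_ball using that by linarith
    then show ?thesis using r(2) by auto
  qed
  have du: "((\<lambda>s. f (x(u := s, v := t))) has_field_derivative pd u f (x(u := s, v := t))) (at s)"
    if "smooth U f" "\<bar>s - x u\<bar> < r / 2" "\<bar>t - x v\<bar> < r / 2" for f s t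
    using smooth_has_deriv[OF that(1) inU[OF that(2,3)], of u] False
    by (simp add: fun_upd_twist)
  have dv: "((\<lambda>t. f (x(u := s, v := t))) has_field_derivative pd v f (x(u := s, v := t))) (at t)"
    if "smooth U f" "\<bar>s - x u\<bar> < r / 2" "\<bar>t - x v\<bar> < r / 2" for f s t
    using smooth_has_deriv[OF that(1) inU[OF that(2,3)], of v] by simp
  have c: "isCont (\<lambda>(s, t). f (x(u := s, v := t))) (x u, x v)" if "smooth U f" for f
  proof -
    have "isCont (f \<circ> ?\<phi>) (x u, x v)"
    proof (rule continuous_at_compose)
      show "isCont ?\<phi> (x u, x v)"
        using continuous_on_fun_upd2[of UNIV x u v] by (simp add: continuous_on_eq_continuous_at)
      show "isCont f (?\<phi> (x u, x v))"
        using smooth_continuous[OF that] open_U x by (simp add: continuous_on_eq_continuous_at)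
    qed
    then show ?thesis by (simp add: o_def case_prod_beta')
  qed
  have "pd v (pd u g) (x(u := x u, v := x v)) = pd u (pd v g) (x(u := x u, v := x v))"
    by (rule clairaut_real[of "r / 2" "x u" "x v" "\<lambda>s t. g (x(u := s, v := t))"
          "\<lambda>s t. pd u g (x(u := s, v := t))" "\<lambda>s t. pd v g (x(u := s, v := t))"
          "\<lambda>s t. pd v (pd u g) (x(u := s, v := t))" "\<lambda>s t. pd u (pd v g) (x(u := s, v := t))"])
      (use r g in \<open>auto intro!: du dv c smooth_pd\<close>)
  then show ?thesis by simp
qed simp

end

section \<open>The calculus of superfunctions\<close>

definition sscale :: "real \<Rightarrow> sfun \<Rightarrow> sfun" where
  "sscale c f = (\<lambda>x. c *\<^sub>R f x)"

definition sflip :: "nat \<Rightarrow> sfun \<Rightarrow> sfun" where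
  "sflip e f = (\<lambda>x. flip e (f x))"

lemma sscale_simps:
  "sscale c (f + g) = sscale c f + sscale c g" "sscale c (sscale d f) = sscale (c * d) f" "sscale 1 f = f"
  "f * sscale c g = sscale c (f * g)" "sscale c f * g = sscale c (f * g)" "sscale c 0 = 0" "sscale 0 f = 0"
  by (simp_all add: sscale_def fun_eq_iff scaleR_right_distrib)

lemma sum_fun_apply: "(\<Sum>i\<in>I. f i) x = (\<Sum>i\<in>I. f i x)"
  by (induction I rule: infinite_finite_induct) auto

lemma sscale_sum: "sscale c (\<Sum>i\<in>I. f i) = (\<Sum>i\<in>I. sscale c (f i))"
  by (simp add: sscale_def fun_eq_iff sum_fun_apply scaleR_sum_right)

lemma par_bit: "par A = 0 \<or> par A = 1"
  by (cases A) auto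

lemma vpar_bit: "vpar v = 0 \<or> vpar v = 1"
  using par_bit by (cases v) auto

lemma finite_Idx [simp]: "finite (Idx n m)"
  by (simp add: Idx_def)

lemma coord_mult_commute: "coord v * f = sflip (vpar v) f * coord v"
  using vpar_bit[of v]
  by (auto simp: fun_eq_iff coord_def sflip_def flip_even gen_mult_commute of_real_def)

lemma sflip_coord: "sflip e (coord v) = sscale ((-1) ^ (e * vpar v)) (coord v)"
  using vpar_bit[of v]
  by (auto simp: fun_eq_iff coord_def sflip_def sscale_def flip_of_real flip_gen)

context superdomain
begin

text \<open>Only smoothness of the coefficients is recorded. The class is thus stable under
  multiplication by any \<open>coord v\<close>, in particular by the entries of the added row, which
  are not among the variables of the original form.\<close>

definition ssmooth :: "sfun set" where
  "ssmooth = {f. \<forall>S. smooth U (\<lambda>x. coef (f x) S)}"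

text \<open>
  The derivative is set to \<open>0\<close> outside \<open>U\<close>, where nothing is known, so that identities valid on \<open>U\<close>
  become equations of functions that can be used under further operators.
\<close>

definition der :: "var \<Rightarrow> sfun \<Rightarrow> sfun" where
  "der v f x = (if x \<in> U then D v f x else 0)"

lemma coef_der:
  assumes "x \<in> U"
  shows "coef (der v f x) S =
    (if vpar v = 0 then pd v (\<lambda>y. coef (f y) S) x
     else if to_nat v \<in> S then 0 else gsign {to_nat v} S * coef (f x) (insert (to_nat v) S))"
  using assms by (simp add: der_def D_def coef_mk_grass coef_left_deriv coef_infinite pd_const)

lemma D_cong:
  assumes "\<And>y. y \<in> U \<Longrightarrow> f y = g y" "x \<in> U"
  shows "D v f x = D v g x"
  using assms by (auto simp: D_def intro!: arg_cong[of _ _ mk_grass] pd_cong)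

lemma ssmooth_add: "f \<in> ssmooth \<Longrightarrow> g \<in> ssmooth \<Longrightarrow> f + g \<in> ssmooth"
  by (auto simp: ssmooth_def coef_simps intro: smooth_add)

lemma ssmooth_mult: "f \<in> ssmooth \<Longrightarrow> g \<in> ssmooth \<Longrightarrow> f * g \<in> ssmooth"
  by (auto simp: ssmooth_def coef_mult intro!: smooth_sum smooth_mult smooth_const)

lemma ssmooth_zero: "0 \<in> ssmooth"
  by (auto simp: ssmooth_def coef_simps intro!: smooth_const)

lemma ssmooth_sum: "(\<And>i. i \<in> I \<Longrightarrow> f i \<in> ssmooth) \<Longrightarrow> (\<Sum>i\<in>I. f i) \<in> ssmooth"
  by (induction I rule: infinite_finite_induct) (auto intro: ssmooth_add ssmooth_zero simp del: plus_fun_apply)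

lemma ssmooth_sscale: "f \<in> ssmooth \<Longrightarrow> sscale c f \<in> ssmooth"
  by (auto simp: ssmooth_def sscale_def coef_simps intro!: smooth_mult smooth_const)

lemma ssmooth_sflip: "f \<in> ssmooth \<Longrightarrow> sflip e f \<in> ssmooth"
  by (auto simp: ssmooth_def sflip_def coef_flip intro!: smooth_mult smooth_const)

lemma ssmooth_coord: "coord v \<in> ssmooth"
  using vpar_bit[of v]
  by (auto simp: ssmooth_def coord_def of_real_def coef_simps intro!: smooth_const smooth_coord smooth_mult)

lemma ssmooth_der:
  assumes "f \<in> ssmooth"
  shows "der v f \<in> ssmooth"
  unfolding ssmooth_def
proof (intro CollectI allI)
  fix S
  show "smooth U (\<lambda>x. coef (der v f x) S)"
    using assms
    by (intro smooth_cong[OF _ coef_der]; cases "vpar v = 0"; cases "to_nat v \<in> S")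
      (auto simp: ssmooth_def intro!: smooth_pd smooth_mult smooth_const)
qed

lemmas ssmooth_intros = ssmooth_add ssmooth_mult ssmooth_zero ssmooth_sum ssmooth_sscale ssmooth_sflip ssmooth_coord ssmooth_der

lemma sfun_eqI:
  assumes "\<And>x S. x \<in> U \<Longrightarrow> coef (f x) S = coef (g x) S" "\<And>x. x \<notin> U \<Longrightarrow> f x = g x"
  shows "f = g"
  using assms by (metis ext grass_eqI)

lemma der_outside: "x \<notin> U \<Longrightarrow> der v f x = 0"
  by (simp add: der_def)

lemma ssmooth_D: "f \<in> ssmooth \<Longrightarrow> smooth U (\<lambda>x. coef (f x) S)"
  by (simp add: ssmooth_def)

lemma der_add: "f \<in> ssmooth \<Longrightarrow> g \<in> ssmooth \<Longrightarrow> der v (f + g) = der v f + der v g"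
  by (rule sfun_eqI) (auto simp: coef_der der_outside coef_simps pd_add ssmooth_D algebra_simps)

lemma der_zero: "der v 0 = 0"
  by (rule sfun_eqI) (auto simp: coef_der der_outside coef_simps pd_const)

lemma der_sum: "(\<And>i. i \<in> I \<Longrightarrow> f i \<in> ssmooth) \<Longrightarrow> der v (\<Sum>i\<in>I. f i) = (\<Sum>i\<in>I. der v (f i))"
  by (induction I rule: infinite_finite_induct) (auto simp: der_zero der_add ssmooth_sum)

lemma der_sscale: "f \<in> ssmooth \<Longrightarrow> der v (sscale c f) = sscale c (der v f)"
  by (rule sfun_eqI) (auto simp: coef_der der_outside coef_simps sscale_def pd_mult pd_const smooth_const ssmooth_D)

text \<open>For an even variable the flip is the identity and the product rule is applied
  coefficient by coefficient; for an odd one this is \<open>left_deriv_mult\<close> at each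
  point.\<close>

lemma der_mult:
  assumes "f \<in> ssmooth" "g \<in> ssmooth"
  shows "der v (f * g) = der v f * g + sflip (vpar v) f * der v g"
proof (cases "vpar v = 0")
  case True
  show ?thesis
  proof (rule sfun_eqI)
    fix x S assume x: "x \<in> U"
    show "coef (der v (f * g) x) S = coef ((der v f * g + sflip (vpar v) f * der v g) x) S"
      using True x assms
      by (simp add: coef_der coef_mult coef_simps pd_sum pd_mult smooth_mult smooth_const ssmooth_D pd_const
          sflip_def flip_even sum.distrib distrib_left)
  qed (simp add: der_outside)
next
  case False
  then have "vpar v = 1" using vpar_bit[of v] by auto
  then show ?thesis
    by (auto simp: fun_eq_iff der_def D_def left_deriv_mult sflip_def)
qed

lemma der_sflip:
  assumes "f \<in> ssmooth"
  shows "der v (sflip e f) = sscale ((-1) ^ (e * vpar v)) (sflip e (der v f))"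
proof (cases "vpar v = 0")
  case True
  show ?thesis
    by (rule sfun_eqI)
      (use True assms in \<open>auto simp: coef_der der_outside coef_simps sscale_def sflip_def coef_flip pd_mult
          pd_const smooth_const ssmooth_D flip_zero\<close>)
next
  case False
  then have "vpar v = 1" using vpar_bit[of v] by auto
  then show ?thesis
    by (auto simp: fun_eq_iff der_def D_def left_deriv_flip sflip_def sscale_def flip_zero)
qed

text \<open>Two even variables: symmetry of second derivatives of the coefficients. Two odd ones:
  \<open>left_deriv_left_deriv\<close>. In the mixed case the odd derivative only relabels
  coefficients up to constant signs, and the even one acts on each coefficient separately.\<close>

lemma der_commute:
  assumes f: "f \<in> ssmooth"
  shows "der u (der v f) = sscale ((-1) ^ (vpar u * vpar v)) (der v (der u f))"
proof (rule sfun_eqI)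
  fix x S assume x: "x \<in> U"
  have ev: "pd a (\<lambda>y. coef (der b f y) S) x =
      pd a (\<lambda>y. if vpar b = 0 then pd b (\<lambda>y. coef (f y) S) y
     else if to_nat b \<in> S then 0 else gsign {to_nat b} S * coef (f y) (insert (to_nat b) S)) x" for a b
    by (rule pd_cong[OF coef_der x])
  show "coef (der u (der v f) x) S = coef (sscale ((-1) ^ (vpar u * vpar v)) (der v (der u f)) x) S"
  proof (cases "vpar u = 0 \<or> vpar v = 0")
    case True
    then show ?thesis
      using x f vpar_bit[of u] vpar_bit[of v] pd_commute[OF ssmooth_D[OF f] x]
      by (auto simp: sscale_def coef_simps coef_der ev pd_mult pd_const smooth_const ssmooth_D)
  next
    case False
    then have "vpar u = 1" "vpar v = 1" using vpar_bit[of u] vpar_bit[of v] by auto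
    then show ?thesis
      using x by (simp add: der_def D_def sscale_def left_deriv_left_deriv[of "to_nat u"])
  qed
qed (simp add: der_outside sscale_def)

lemma der_coord: "u \<noteq> v \<Longrightarrow> der v (coord u) = 0"
proof (rule sfun_eqI)
  fix x S assume "x \<in> U" "u \<noteq> v"
  then show "coef (der v (coord u) x) S = coef (0 x) S"
    by (auto simp: coef_der coord_def of_real_def coef_simps coef_gen pd_const pd_coord)
qed (simp add: der_outside)

lemma der_coord_mult:
  "u \<noteq> v \<Longrightarrow> g \<in> ssmooth \<Longrightarrow>
    der v (coord u * g) = sscale ((-1) ^ (vpar v * vpar u)) (coord u * der v g)"
  by (simp add: der_mult ssmooth_coord der_coord sflip_coord sscale_simps)

end

section \<open>The operators on a coordinate domain\<close>

lemma sflip_sflip: "sflip a (sflip b f) = sflip (a + b) f"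
  by (simp add: sflip_def flip_flip)

lemma sflip_cong: "even a \<longleftrightarrow> even b \<Longrightarrow> sflip a f = sflip b f"
  unfolding sflip_def using flip_cong by blast

lemma sscale_neg_self_zero:
  assumes "f = sscale (-1) f"
  shows "f = 0"
proof
  fix x
  have "f x = - f x" using assms by (metis sscale_def scaleR_minus1_left)
  then have "2 *\<^sub>R f x = 0" by (simp add: scaleR_2 eq_neg_iff_add_eq_0)
  then show "f x = 0 x" by simp
qed

lemma sflip_zero: "sflip c 0 = 0"
  by (simp add: sflip_def flip_zero fun_eq_iff)

section \<open>Signs of inserting one letter into a sorted word\<close>

lemma sort_snoc:
  assumes "sorted (H @ T)" "\<And>b. b \<in> set H \<Longrightarrow> b \<le> A" "\<And>b. b \<in> set T \<Longrightarrow> A < b"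
  shows "sort (H @ T @ [A]) = H @ A # T"
  by (rule properties_for_sort) (use assms in \<open>auto simp: sorted_append less_imp_le\<close>)

text \<open>As H followed by T is sorted, with letters at most A in H and above A in T, the
  inversions are exactly the pairs formed by a letter of T and the final A.\<close>

lemma word_sign_snoc:
  assumes "sorted (H @ T)" "\<And>b. b \<in> set H \<Longrightarrow> b \<le> A" "\<And>b. b \<in> set T \<Longrightarrow> A < b"
    and dist: "distinct (filter (\<lambda>A. par A = 0) (H @ T @ [A]))"
  shows "word_sign (H @ T @ [A]) = (\<Prod>b\<leftarrow>T. - ((-1) ^ (par b * par A)))"
proof -
  let ?I = "H @ T" and ?w = "H @ T @ [A]"
  have w1: "?w ! a = ?I ! a" if "a < length ?I" for a
    using that by (metis append_assoc nth_append_left)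
  have w2: "?w ! length ?I = A" by (metis append_assoc nth_append_length)
  have big: "A < ?I ! a \<longleftrightarrow> length H \<le> a" if "a < length ?I" for a
  proof (cases "a < length H")
    case True
    then show ?thesis using assms(2)[of "H ! a"] by (auto simp: nth_append not_less)
  next
    case False
    then show ?thesis using assms(3)[of "T ! (a - length H)"] that by (auto simp: nth_append)
  qed
  have "{(a, b). a < b \<and> b < length ?w \<and> ?w ! b < ?w ! a}
      = (\<lambda>i. (length H + i, length ?I)) ` {0..<length T}"
  proof (intro set_eqI iffI; clarify)
    fix a b assume *: "a < b" "b < length ?w" "?w ! b < ?w ! a"
    have b: "b = length ?I"
    proof (rule ccontr)
      assume "b \<noteq> length ?I"
      then have "b < length ?I" using * by simp
      then have "?I ! a \<le> ?I ! b" using assms(1) * by (intro sorted_nth_mono) auto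
      then show False using * w1 \<open>b < length ?I\<close> by (metis less_trans not_less)
    qed
    then have "length H \<le> a" using * w1[of a] w2 big[of a] by simp
    then show "(a, b) \<in> (\<lambda>i. (length H + i, length ?I)) ` {0..<length T}"
      using b * by (intro image_eqI[of _ _ "a - length H"]) auto
  next
    fix i assume "i \<in> {0..<length T}"
    then show "length H + i < length ?I \<and> length ?I < length ?w \<and> ?w ! length ?I < ?w ! (length H + i)"
      using big[of "length H + i"] w1[of "length H + i"] w2 by simp
  qed
  then have "word_sign ?w = (\<Prod>(a, b)\<in>(\<lambda>i. (length H + i, length ?I)) ` {0..<length T}.
      - ((-1) ^ (par (?w ! a) * par (?w ! b))))"
    unfolding word_sign_def using dist by (simp only: if_True)
  also have "\<dots> = (\<Prod>i\<in>{0..<length T}. - ((-1) ^ (par (T ! i) * par A)))"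
    using w2 by (subst prod.reindex) (auto simp: inj_on_def nth_append intro!: prod.cong)
  also have "\<dots> = (\<Prod>b\<leftarrow>T. - ((-1) ^ (par b * par A)))"
    by (simp add: prod.list_conv_set_nth)
  finally show ?thesis .
qed

lemma finite_words [simp]: "finite (words n m k)"
  by (rule finite_subset[of _ "{I. set I \<subseteq> Idx n m \<and> length I = k}"])
    (auto simp: words_def finite_lists_length_eq)

locale mixed_domain = superdomain +
  fixes n m p q :: nat
begin

text \<open>This is e(dx^A) on forms with r even rows. The 1-form dx^A has parity A and coefficient
  1, so the sign in the general formula is (-1)^(A A) = (-1)^A.\<close>

definition ext_op :: "nat \<Rightarrow> idx \<Rightarrow> sfun \<Rightarrow> sfun" where
  "ext_op r A f = sscale ((-1) ^ (r + par A)) (\<Sum>K\<in>Idx p q. coord (W (Ev r) K) * der (P A K) f)"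

primrec ext_word :: "nat \<Rightarrow> idx list \<Rightarrow> sfun \<Rightarrow> sfun" where
  "ext_word r [] f = f"
| "ext_word r (A # I) f = ext_op (r + length I) A (ext_word r I f)"

definition dbar_op :: "nat \<Rightarrow> sfun \<Rightarrow> sfun" where
  "dbar_op r f = (\<Sum>A\<in>Idx n m. sscale ((-1) ^ par A) (der (X A) (ext_op r A f)))"

definition alternating :: "sfun \<Rightarrow> bool" where
  "alternating f \<longleftrightarrow> (\<forall>A\<in>Idx n m. \<forall>B\<in>Idx n m. \<forall>K\<in>Idx p q. \<forall>J\<in>Idx p q.
     der (P A K) (der (P B J) f)
       = sscale (- ((-1) ^ (par A * par B + (par A + par B) * par J))) (der (P B K) (der (P A J) f)))"

text \<open>Independence of the entries of p is the property retained of a function of x. It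
  survives \<open>der\<close> in every variable, so derivatives of the coefficients of a naive form
  are covered as well.\<close>

definition basic :: "sfun \<Rightarrow> bool" where
  "basic f \<longleftrightarrow> f \<in> ssmooth \<and> (\<forall>A\<in>Idx n m. \<forall>K\<in>Idx p q. der (P A K) f = 0)"

section \<open>Linearity and graded commutation of the operators\<close>

lemma ssmooth_ext_op: "f \<in> ssmooth \<Longrightarrow> ext_op r A f \<in> ssmooth"
  unfolding ext_op_def by (intro ssmooth_intros)

lemma ssmooth_ext_word: "f \<in> ssmooth \<Longrightarrow> ext_word r I f \<in> ssmooth"
  by (induction I) (auto intro: ssmooth_ext_op)

lemma ssmooth_dbar_op: "f \<in> ssmooth \<Longrightarrow> dbar_op r f \<in> ssmooth"
  unfolding dbar_op_def by (intro ssmooth_intros ssmooth_ext_op)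

lemma ext_op_sum: "(\<And>i. i \<in> I \<Longrightarrow> f i \<in> ssmooth) \<Longrightarrow> ext_op r A (\<Sum>i\<in>I. f i) = (\<Sum>i\<in>I. ext_op r A (f i))"
  unfolding ext_op_def
  by (simp add: der_sum sum_distrib_left sscale_sum[symmetric]) (subst sum.swap, simp)

lemma ext_op_sscale: "f \<in> ssmooth \<Longrightarrow> ext_op r A (sscale c f) = sscale c (ext_op r A f)"
  unfolding ext_op_def by (simp add: der_sscale sscale_simps sscale_sum mult.commute)

lemma ext_op_zero: "ext_op r A 0 = 0"
  unfolding ext_op_def by (simp add: der_zero sscale_simps)

lemma ext_word_sum: "(\<And>i. i \<in> N \<Longrightarrow> f i \<in> ssmooth) \<Longrightarrow> ext_word r I (\<Sum>i\<in>N. f i) = (\<Sum>i\<in>N. ext_word r I (f i))"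
  by (induction I) (auto simp: ext_op_sum ssmooth_ext_word)

lemma ext_word_sscale: "f \<in> ssmooth \<Longrightarrow> ext_word r I (sscale c f) = sscale c (ext_word r I f)"
  by (induction I) (auto simp: ext_op_sscale ssmooth_ext_word)

lemma ext_word_zero: "ext_word r I 0 = 0"
  by (induction I) (simp_all only: ext_word.simps ext_op_zero)

lemma ext_word_add: "f \<in> ssmooth \<Longrightarrow> g \<in> ssmooth \<Longrightarrow> ext_word r I (f + g) = ext_word r I f + ext_word r I g"
  using ext_word_sum[of "UNIV :: bool set" "\<lambda>b. if b then f else g" r I] by (simp add: UNIV_bool add.commute)

lemma ext_word_append: "ext_word r (H @ T) f = ext_word (r + length T) H (ext_word r T f)"
  by (induction H) (auto simp: add_ac)

text \<open>\<open>ext_op r C\<close> has parity \<open>par C\<close>: in each summand a coordinate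
  of parity K is followed by a derivative of parity C + K, so the sign of passing through both is
  independent of K. The condition on v makes the coordinates of row r constants for
  \<open>der v\<close>.\<close>

lemma der_ext_op:
  assumes f: "f \<in> ssmooth" and v: "\<And>K. v \<noteq> W (Ev r) K"
  shows "der v (ext_op r C f) = sscale ((-1) ^ (par C * vpar v)) (ext_op r C (der v f))"
proof -
  have "der v (coord (W (Ev r) K) * der (P C K) f)
      = sscale ((-1) ^ (par C * vpar v)) (coord (W (Ev r) K) * der (P C K) (der v f))" for K
  proof -
    have "(-1) ^ (vpar v * vpar (W (Ev r) K)) * (-1) ^ (vpar v * vpar (P C K))
        = (-1 :: real) ^ (par C * vpar v)"
      using par_bit[of K] par_bit[of C] vpar_bit[of v] by auto
    then show ?thesis
      using f v[of K]
      by (simp add: der_coord_mult ssmooth_der der_commute[OF f, of v "P C K"] sscale_simps del: vpar.simps)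
  qed
  then show ?thesis
    using f by (simp add: ext_op_def der_sscale der_sum ssmooth_intros sscale_sum sscale_simps mult.commute)
qed

text \<open>Moving both derivatives through \<open>ext_op\<close> costs a sign governed by the total
  parity A + B + K + J, which does not change when A and B are exchanged.\<close>

lemma alternating_ext_op:
  assumes f: "f \<in> ssmooth" and "alternating f"
  shows "alternating (ext_op r C f)"
  unfolding alternating_def
proof (intro ballI)
  fix A B K J
  assume *: "A \<in> Idx n m" "B \<in> Idx n m" "K \<in> Idx p q" "J \<in> Idx p q"
  have **: "der (P A K) (der (P B J) (ext_op r C f))
      = sscale ((-1) ^ (par C * vpar (P B J)) * (-1) ^ (par C * vpar (P A K)))
          (ext_op r C (der (P A K) (der (P B J) f)))" for A B
    using f by (simp add: der_ext_op der_sscale ssmooth_intros ssmooth_ext_op sscale_simps del: vpar.simps)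
  have "(-1) ^ (par C * vpar (P B J)) * (-1) ^ (par C * vpar (P A K))
      = (-1) ^ (par C * vpar (P A J)) * (-1 :: real) ^ (par C * vpar (P B K))"
    using par_bit[of A] par_bit[of B] par_bit[of C] par_bit[of K] par_bit[of J] by auto
  moreover have "der (P A K) (der (P B J) f)
       = sscale (- ((-1) ^ (par A * par B + (par A + par B) * par J))) (der (P B K) (der (P A J) f))"
    using assms(2) * unfolding alternating_def by blast
  ultimately show "der (P A K) (der (P B J) (ext_op r C f))
       = sscale (- ((-1) ^ (par A * par B + (par A + par B) * par J))) (der (P B K) (der (P A J) (ext_op r C f)))"
    using f by (simp add: ** ext_op_sscale ssmooth_intros sscale_simps mult.commute del: vpar.simps)
qed

lemma alternating_ext_word: "f \<in> ssmooth \<Longrightarrow> alternating f \<Longrightarrow> alternating (ext_word r I f)"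
  by (induction I) (auto intro: alternating_ext_op ssmooth_ext_word)

text \<open>In the expanded double sum the exchange of A and B leaves the columns J and K attached
  to their rows, so the products of w entries need no reordering. The J-dependent sign of
  \<open>alternating\<close> cancels the signs from moving the derivative in column J through the
  inner operator.\<close>

lemma ext_op_ext_op:
  assumes f: "f \<in> ssmooth" and alt: "alternating f" and AB: "A \<in> Idx n m" "B \<in> Idx n m"
  shows "ext_op (Suc r) A (ext_op r B f) = sscale (- ((-1) ^ (par A * par B))) (ext_op (Suc r) B (ext_op r A f))"
proof -
  have *: "ext_op (Suc r) A (ext_op r B f) = (\<Sum>J\<in>Idx p q. \<Sum>K\<in>Idx p q.
      sscale ((-1) ^ (Suc r + par A) * (-1) ^ (par B * vpar (P A J)) * (-1) ^ (r + par B))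
        (coord (W (Ev (Suc r)) J) * (coord (W (Ev r) K) * der (P B K) (der (P A J) f))))" for A B
    unfolding ext_op_def[of "Suc r"]
    using f by (simp add: der_ext_op del: vpar.simps) (simp add: ext_op_def sscale_simps sscale_sum sum_distrib_left mult_ac
        del: vpar.simps)
  have "der (P B K) (der (P A J) f) = sscale (- ((-1) ^ (par B * par A + (par B + par A) * par J)))
      (der (P A K) (der (P B J) f))" if "J \<in> Idx p q" "K \<in> Idx p q" for J K
    using alt AB that unfolding alternating_def by blast
  then show ?thesis
    unfolding *[of A] *[of B] sscale_sum
    apply (intro sum.cong refl)
    apply (simp add: sscale_simps del: vpar.simps power_Suc)
    subgoal for J K
      using par_bit[of A] par_bit[of B] par_bit[of J]
      by (auto simp: power_add)
    done
qed

lemma dbar_op_ext_op: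
  assumes f: "f \<in> ssmooth" and alt: "alternating f" and B: "B \<in> Idx n m"
  shows "dbar_op (Suc r) (ext_op r B f) = sscale (-1) (ext_op (Suc r) B (dbar_op r f))"
proof -
  have "dbar_op (Suc r) (ext_op r B f) = (\<Sum>A\<in>Idx n m. sscale ((-1) ^ par A)
      (der (X A) (sscale (- ((-1) ^ (par A * par B))) (ext_op (Suc r) B (ext_op r A f)))))"
    unfolding dbar_op_def using ext_op_ext_op[OF f alt _ B] by simp
  also have "\<dots> = (\<Sum>A\<in>Idx n m. sscale (-1) (ext_op (Suc r) B (sscale ((-1) ^ par A) (der (X A) (ext_op r A f)))))"
  proof (rule sum.cong)
    fix A
    \<comment> \<open>Moving \<open>der (X A)\<close> through \<open>ext_op (Suc r) B\<close>
      produces a second (-1)^(AB), which cancels the one from exchanging the two operators; only -1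
      remains. The factor (-1)^(A A) occurs on both sides.\<close>
    have *: "(-1) ^ par A * (- ((-1) ^ (par A * par B)) * ((-1) ^ (par B * par A) * (-1) ^ (par A * par A)))
        = (- 1 * ((-1 :: real) ^ par A * (-1) ^ (par A * par A)))"
      using par_bit[of A] par_bit[of B] by auto
    show "sscale ((-1) ^ par A) (der (X A) (sscale (- ((-1) ^ (par A * par B))) (ext_op (Suc r) B (ext_op r A f))))
      = sscale (-1) (ext_op (Suc r) B (sscale ((-1) ^ par A) (der (X A) (ext_op r A f))))"
      using f by (simp only: der_sscale der_ext_op ext_op_sscale ssmooth_ext_op ssmooth_intros sscale_simps vpar.simps var.distinct simp_thms *)
  qed simp
  also have "\<dots> = sscale (-1) (ext_op (Suc r) B (dbar_op r f))"
    using f by (simp add: dbar_op_def ext_op_sum ssmooth_ext_op ssmooth_intros sscale_sum)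
  finally show ?thesis .
qed

lemma dbar_op_ext_word:
  assumes f: "f \<in> ssmooth" and alt: "alternating f" and "set I \<subseteq> Idx n m"
  shows "dbar_op (length I + r) (ext_word r I f) = sscale ((-1) ^ length I) (ext_word (Suc r) I (dbar_op r f))"
  using assms(3)
proof (induction I)
  case (Cons A I)
  then show ?case
    using f alt by (simp add: dbar_op_ext_op ssmooth_ext_word ssmooth_dbar_op alternating_ext_word add.commute ext_op_sscale sscale_simps)
qed (simp add: sscale_simps)

section \<open>Multiplication by functions of x\<close>

lemma basic_der: "basic f \<Longrightarrow> basic (der v f)"
  unfolding basic_def by (auto simp: der_commute[of _ "P _ _"] der_zero sscale_simps intro: ssmooth_der)

text \<open>Both derivatives pass the factor f and flip it by their total parity, which is symmetric
  in A and B.\<close>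

lemma alternating_mult:
  assumes f: "basic f" and g: "g \<in> ssmooth" "alternating g"
  shows "alternating (f * g)"
  unfolding alternating_def
proof (intro ballI)
  fix A B K J
  assume *: "A \<in> Idx n m" "B \<in> Idx n m" "K \<in> Idx p q" "J \<in> Idx p q"
  have **: "der (P A K) (der (P B J) (f * g))
      = sflip (vpar (P A K) + vpar (P B J)) f * der (P A K) (der (P B J) g)"
    if "A \<in> Idx n m" "B \<in> Idx n m" for A B
    using f g that * unfolding basic_def
    by (simp add: der_mult ssmooth_intros der_sflip sflip_sflip sflip_zero sscale_simps
        del: vpar.simps zero_fun_apply)
  have "sflip (vpar (P A K) + vpar (P B J)) f = sflip (vpar (P B K) + vpar (P A J)) f"
    by (rule sflip_cong) auto
  moreover have "der (P A K) (der (P B J) g)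
       = sscale (- ((-1) ^ (par A * par B + (par A + par B) * par J))) (der (P B K) (der (P A J) g))"
    using g(2) * unfolding alternating_def by blast
  ultimately show "der (P A K) (der (P B J) (f * g))
       = sscale (- ((-1) ^ (par A * par B + (par A + par B) * par J))) (der (P B K) (der (P A J) (f * g)))"
    using * by (simp add: ** sscale_simps del: vpar.simps)
qed

lemma ext_op_mult:
  assumes f: "basic f" and g: "g \<in> ssmooth" and A: "A \<in> Idx n m"
  shows "ext_op r A (f * g) = sflip (par A) f * ext_op r A g"
proof -
  have "coord (W (Ev r) K) * der (P A K) (f * g) = sflip (par A) f * (coord (W (Ev r) K) * der (P A K) g)"
    if "K \<in> Idx p q" for K
  proof -
    have "sflip (vpar (W (Ev r) K) + vpar (P A K)) f = sflip (par A) f"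
      by (rule sflip_cong) auto
    then show ?thesis
      using f g A that coord_mult_commute[of "W (Ev r) K" "sflip (vpar (P A K)) f"] unfolding basic_def
      by (simp add: der_mult sflip_sflip mult.assoc[symmetric] del: vpar.simps)
  qed
  then show ?thesis
    by (simp add: ext_op_def sscale_simps sum_distrib_left)
qed

text \<open>\<open>ext_op r A\<close> passes f with a flip by A. When \<open>der (X A)\<close> hits
  the flipped f, the sign (-1)^(A A) cancels the prefactor (-1)^A, and \<open>ext_op_mult\<close>
  read backwards collects the first sum. When it passes f, the flip by A occurs twice and
  disappears.\<close>

lemma dbar_op_mult:
  assumes f: "basic f" and g: "g \<in> ssmooth"
  shows "dbar_op r (f * g) = (\<Sum>A\<in>Idx n m. ext_op r A (der (X A) f * g)) + f * dbar_op r g"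
proof -
  have fS: "f \<in> ssmooth" using f by (simp add: basic_def)
  have "sscale ((-1) ^ par A) (der (X A) (ext_op r A (f * g)))
      = ext_op r A (der (X A) f * g) + f * sscale ((-1) ^ par A) (der (X A) (ext_op r A g))"
    if A: "A \<in> Idx n m" for A
  proof -
    have "sflip (par A + par A) f = f"
      by (simp add: sflip_def flip_even)
    then show ?thesis
      using fS g
      by (simp add: ext_op_mult[OF f g A] ext_op_mult[OF basic_der[OF f] g A] der_mult ssmooth_intros ssmooth_ext_op der_sflip
          sflip_sflip sscale_simps) (simp add: sscale_simps flip: power_add mult_2)
  qed
  then show ?thesis
    by (simp add: dbar_op_def sum.distrib sum_distrib_left)
qed

section \<open>Reordering words and the local Leibniz formula\<close>

lemma ext_word_snoc_shift:
  assumes f: "f \<in> ssmooth" "alternating f" and A: "A \<in> Idx n m" "set T \<subseteq> Idx n m"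
  shows "ext_word r (T @ [A]) f = sscale (\<Prod>b\<leftarrow>T. - ((-1) ^ (par b * par A))) (ext_word r (A # T) f)"
  using A(2)
proof (induction T)
  case (Cons b T)
  then show ?case
    using ext_op_ext_op[of "ext_word r T f" b A "r + length T"] A(1) f
    by (simp add: ext_op_sscale ssmooth_ext_op ssmooth_ext_word alternating_ext_word sscale_simps mult.commute)
qed (simp add: sscale_simps)

text \<open>The right-hand sum has at most one nonzero term. It is written over all J so that it can
  be matched with the coefficients of the differential, each of which collects the pairs (I, A)
  sorting to the same J.\<close>

lemma ext_word_snoc:
  assumes f: "f \<in> ssmooth" "alternating f" and A: "A \<in> Idx n m" and I: "I \<in> words n m k"
  shows "ext_word r (I @ [A]) f =
    (\<Sum>J\<in>words n m (Suc k). if sort (I @ [A]) = J then sscale (word_sign (I @ [A])) (ext_word r J f) else 0)"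
proof -
  define H T where "H = takeWhile (\<lambda>b. b \<le> A) I" and "T = dropWhile (\<lambda>b. b \<le> A) I"
  have I': "sorted I" "set I \<subseteq> Idx n m" "length I = k" "distinct (filter (\<lambda>A. par A = 0) I)"
    using I by (auto simp: words_def normal_word_def)
  have IHT: "I = H @ T" by (simp add: H_def T_def)
  have H: "b \<le> A" if "b \<in> set H" for b using that unfolding H_def by (auto dest: set_takeWhileD)
  have T: "A < b" if "b \<in> set T" for b
  proof -
    have "T \<noteq> []" using that by auto
    then have "\<not> hd T \<le> A" unfolding T_def by (rule hd_dropWhile)
    moreover have "hd T \<le> b"
      using I'(1) that \<open>T \<noteq> []\<close> unfolding IHT by (cases T) (auto simp: sorted_append)
    ultimately show ?thesis by simp
  qed
  have sub: "set T \<subseteq> Idx n m" "set H \<subseteq> Idx n m" using I'(2) IHT by auto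
  have srt: "sort (I @ [A]) = H @ A # T"
    using sort_snoc[of H T A] I'(1) H T unfolding IHT by simp
  have ews: "ext_word r (I @ [A]) f = sscale (\<Prod>b\<leftarrow>T. - ((-1) ^ (par b * par A))) (ext_word r (H @ A # T) f)"
    using f A sub unfolding IHT
    by (simp add: ext_word_append[of r H] ext_word_snoc_shift ext_word_sscale ssmooth_ext_op ssmooth_ext_word)
  show ?thesis
  proof (cases "distinct (filter (\<lambda>A. par A = 0) (I @ [A]))")
    case True
    then have "distinct (filter (\<lambda>A. par A = 0) (H @ A # T))"
      unfolding IHT by auto
    moreover have "sorted (H @ A # T)" using srt by (metis sorted_sort)
    ultimately have "H @ A # T \<in> words n m (Suc k)"
      using sub A I'(3) unfolding words_def normal_word_def IHT by auto
    moreover have "word_sign (I @ [A]) = (\<Prod>b\<leftarrow>T. - ((-1) ^ (par b * par A)))"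
      using word_sign_snoc[of H T A] I'(1) H T True unfolding IHT by simp
    ultimately show ?thesis by (simp add: srt ews)
  next
    case False
    \<comment> \<open>The sorted word is not normal, so the right-hand sum vanishes. The repeated
      even letter A is the last letter of H, next to the inserted one, and exchanging two equal even
      operators gives e_A e_A = - e_A e_A.\<close>
    then have par0: "par A = 0" and "A \<in> set I" using I'(4) by (auto split: if_splits)
    then have AH: "A \<in> set H" using T IHT by auto
    then have "H \<noteq> []" by auto
    then obtain H' a where Ha: "H = H' @ [a]" by (metis rev_exhaust)
    have "a = A"
      using AH I'(1) H[of a] unfolding IHT Ha by (force simp: sorted_append)
    have "ext_op (Suc (r + length T)) A (ext_op (r + length T) A (ext_word r T f)) = 0"
      using ext_op_ext_op[of "ext_word r T f" A A "r + length T"] f A par0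
      by (intro sscale_neg_self_zero) (simp add: ssmooth_ext_word alternating_ext_word)
    then have "ext_word r (H @ A # T) f = 0"
      unfolding Ha \<open>a = A\<close> by (simp add: ext_word_append ext_word_zero)
    moreover have "word_sign (I @ [A]) = 0"
      unfolding word_sign_def if_not_P[OF False] ..
    ultimately show ?thesis
      by (simp add: ews sscale_simps)
  qed
qed

text \<open>The differential enters through its coefficients at sorted words J. The dbar side
  produces terms indexed by pairs (I, A); grouping them by the sorted word gives these
  coefficients.\<close>

lemma leibniz_local:
  assumes w: "\<And>I. I \<in> words n m k \<Longrightarrow> basic (\<omega> I)" and f: "f \<in> ssmooth" "alternating f"
    and d\<omega>: "\<And>J. J \<in> words n m (Suc k) \<Longrightarrow> d\<omega> J = (\<Sum>I\<in>words n m k. \<Sum>A\<in>Idx n m.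
      if sort (I @ [A]) = J then sscale ((-1) ^ k * word_sign (I @ [A])) (der (X A) (\<omega> I)) else 0)"
  shows "dbar_op (k + r) (\<Sum>I\<in>words n m k. ext_word r I (\<omega> I * f)) =
    (\<Sum>J\<in>words n m (Suc k). ext_word r J (d\<omega> J * f))
    + sscale ((-1) ^ k) (\<Sum>I\<in>words n m k. ext_word (Suc r) I (\<omega> I * dbar_op r f))"
proof -
  have wS: "\<omega> I \<in> ssmooth" if "I \<in> words n m k" for I using w that by (simp add: basic_def)
  have dbar_op_sum: "dbar_op r' (\<Sum>i\<in>N. g i) = (\<Sum>i\<in>N. dbar_op r' (g i))" if "\<And>i. i \<in> N \<Longrightarrow> g i \<in> ssmooth"
    for r' N and g :: "idx list \<Rightarrow> sfun"
    using that by (simp add: dbar_op_def ext_op_sum der_sum ssmooth_ext_op sscale_sum) (rule sum.swap)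
  have "dbar_op (k + r) (\<Sum>I\<in>words n m k. ext_word r I (\<omega> I * f)) =
      (\<Sum>I\<in>words n m k. sscale ((-1) ^ k) (ext_word (Suc r) I (dbar_op r (\<omega> I * f))))"
  proof (subst dbar_op_sum)
    show "(\<Sum>I\<in>words n m k. dbar_op (k + r) (ext_word r I (\<omega> I * f))) =
      (\<Sum>I\<in>words n m k. sscale ((-1) ^ k) (ext_word (Suc r) I (dbar_op r (\<omega> I * f))))"
    proof (rule sum.cong)
      fix I assume I: "I \<in> words n m k"
      then have "length I = k" "set I \<subseteq> Idx n m" by (auto simp: words_def)
      then show "dbar_op (k + r) (ext_word r I (\<omega> I * f)) = sscale ((-1) ^ k) (ext_word (Suc r) I (dbar_op r (\<omega> I * f)))"
        using dbar_op_ext_word[of "\<omega> I * f" I r] wS[OF I] w[OF I] f by (simp add: ssmooth_mult alternating_mult)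
    qed simp
  qed (use wS f in \<open>auto intro: ssmooth_ext_word ssmooth_mult\<close>)
  \<comment> \<open>The operator e_A created by \<open>dbar_op_mult\<close> acts before those of I,
    hence becomes the last letter of the word, and the starting rank drops from \<open>Suc r\<close>
    to \<open>r\<close>.\<close>
  also have "\<dots> = (\<Sum>I\<in>words n m k. sscale ((-1) ^ k) (\<Sum>A\<in>Idx n m. ext_word r (I @ [A]) (der (X A) (\<omega> I) * f)))
      + sscale ((-1) ^ k) (\<Sum>I\<in>words n m k. ext_word (Suc r) I (\<omega> I * dbar_op r f))"
    using wS w f
    by (simp add: dbar_op_mult ext_word_add ext_word_sum ssmooth_ext_op ssmooth_dbar_op ssmooth_intros ext_word_append sscale_simps sscale_sum sum.distrib)
  also have "(\<Sum>I\<in>words n m k. sscale ((-1) ^ k) (\<Sum>A\<in>Idx n m. ext_word r (I @ [A]) (der (X A) (\<omega> I) * f)))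
      = (\<Sum>I\<in>words n m k. \<Sum>A\<in>Idx n m. \<Sum>J\<in>words n m (Suc k). if sort (I @ [A]) = J
          then sscale ((-1) ^ k * word_sign (I @ [A])) (ext_word r J (der (X A) (\<omega> I) * f)) else 0)"
    unfolding sscale_sum
  proof (intro sum.cong refl)
    fix I A assume I: "I \<in> words n m k" and A: "A \<in> Idx n m"
    have "der (X A) (\<omega> I) * f \<in> ssmooth" "alternating (der (X A) (\<omega> I) * f)"
      using w[OF I] wS[OF I] f by (auto intro: ssmooth_intros alternating_mult basic_der)
    then show "sscale ((-1) ^ k) (ext_word r (I @ [A]) (der (X A) (\<omega> I) * f)) =
        (\<Sum>J\<in>words n m (Suc k). if sort (I @ [A]) = J
          then sscale ((-1) ^ k * word_sign (I @ [A])) (ext_word r J (der (X A) (\<omega> I) * f)) else 0)"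
      by (subst ext_word_snoc[OF _ _ A I]) (auto simp: sscale_sum sscale_simps intro!: sum.cong)
  qed
  also have "\<dots> = (\<Sum>J\<in>words n m (Suc k). \<Sum>I\<in>words n m k. \<Sum>A\<in>Idx n m. if sort (I @ [A]) = J
          then sscale ((-1) ^ k * word_sign (I @ [A])) (ext_word r J (der (X A) (\<omega> I) * f)) else 0)"
    (is "?lhs = _")
  proof -
    have "?lhs = (\<Sum>I\<in>words n m k. \<Sum>J\<in>words n m (Suc k). \<Sum>A\<in>Idx n m. if sort (I @ [A]) = J
          then sscale ((-1) ^ k * word_sign (I @ [A])) (ext_word r J (der (X A) (\<omega> I) * f)) else 0)"
      by (intro sum.cong refl sum.swap)
    then show ?thesis by (simp only: sum.swap[of _ "words n m k" "words n m (Suc k)"])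
  qed
  also have "\<dots> = (\<Sum>J\<in>words n m (Suc k). ext_word r J (d\<omega> J * f))"
  proof (rule sum.cong[OF refl])
    fix J assume J: "J \<in> words n m (Suc k)"
    let ?t = "\<lambda>I A. if sort (I @ [A]) = J then sscale ((-1) ^ k * word_sign (I @ [A])) (der (X A) (\<omega> I)) else 0"
    have t: "?t I A * f \<in> ssmooth" if "I \<in> words n m k" for I A
      using wS[OF that] f by (auto intro: ssmooth_intros)
    have "ext_word r J (d\<omega> J * f) = (\<Sum>I\<in>words n m k. \<Sum>A\<in>Idx n m. ext_word r J (?t I A * f))"
      unfolding d\<omega>[OF J] sum_distrib_right
      by (subst ext_word_sum, (intro ssmooth_sum t, assumption)[1]) (intro sum.cong refl ext_word_sum t)
    also have "\<dots> = (\<Sum>I\<in>words n m k. \<Sum>A\<in>Idx n m. if sort (I @ [A]) = J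
          then sscale ((-1) ^ k * word_sign (I @ [A])) (ext_word r J (der (X A) (\<omega> I) * f)) else 0)"
      using wS f by (intro sum.cong refl) (auto simp: sscale_simps ext_word_sscale ext_word_zero ssmooth_intros)
    finally show "(\<Sum>I\<in>words n m k. \<Sum>A\<in>Idx n m. if sort (I @ [A]) = J
          then sscale ((-1) ^ k * word_sign (I @ [A])) (ext_word r J (der (X A) (\<omega> I) * f)) else 0)
      = ext_word r J (d\<omega> J * f)" by simp
  qed
  finally show ?thesis .
qed

end

section \<open>Passage to charts\<close>

text \<open>A nonzero kernel vector can be scaled to l1 norm 1, and such vectors form a compact set
  K. At x0 the function F has no zero on K; by the tube lemma the same holds for all x near
  x0.\<close>

lemma open_trivial_kernel:
  fixes M :: "'x::topological_space \<Rightarrow> 'r \<Rightarrow> nat \<Rightarrow> real"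
  assumes "finite R" and M: "\<And>\<rho> k. continuous_on UNIV (\<lambda>x. M x \<rho> k)"
  shows "open {x. \<forall>c. (\<forall>\<rho>\<in>R. (\<Sum>k<q. M x \<rho> k * c k) = 0) \<longrightarrow> (\<forall>k<q. c k = 0)}" (is "open ?G")
proof (subst open_subopen, intro ballI)
  fix x0 assume x0: "x0 \<in> ?G"
  \<comment> \<open>Vectors are functions on all naturals; fixing the entries from q on to 0 makes
    the box compact by Tychonoff. The truncation in \<open>c'\<close> below serves the same
    purpose.\<close>
  define C where "C = Pi\<^sub>E UNIV (\<lambda>k. if k < q then {-1..1::real} else {0})"
  define F where "F = (\<lambda>(x, c). \<Sum>\<rho>\<in>R. \<bar>\<Sum>k<q. M x \<rho> k * c k\<bar>)"
  define K where "K = C \<inter> {c. (\<Sum>k<q. \<bar>c k\<bar>) = 1}"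
  have "compactin (product_topology (\<lambda>_. euclidean) UNIV) C"
    unfolding C_def by (subst compactin_PiE) auto
  then have "compact C" by (simp add: euclidean_product_topology)
  moreover have "closed {c :: nat \<Rightarrow> real. (\<Sum>k<q. \<bar>c k\<bar>) = 1}"
    by (intro closed_Collect_eq continuous_intros continuous_on_product_coordinates)
  ultimately have K: "compact K"
    unfolding K_def by (rule compact_Int_closed)
  have Mc: "continuous_on UNIV (\<lambda>z :: 'x \<times> (nat \<Rightarrow> real). M (fst z) \<rho> k)" for \<rho> k
    by (rule continuous_on_compose2[OF M]) (auto intro: continuous_intros)
  have cc: "continuous_on UNIV (\<lambda>z :: 'x \<times> (nat \<Rightarrow> real). snd z k)" for k
    by (rule continuous_on_compose2[OF continuous_on_product_coordinates]) (auto intro: continuous_intros)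
  have "continuous_on UNIV F"
    unfolding F_def case_prod_unfold by (intro continuous_intros Mc cc)
  then have W: "open {z. F z \<noteq> 0}"
    by (intro open_Collect_neq continuous_intros)
  have Feq: "F (x, c) = 0 \<longleftrightarrow> (\<forall>\<rho>\<in>R. (\<Sum>k<q. M x \<rho> k * c k) = 0)" for x c
    unfolding F_def using assms(1) by (simp add: sum_nonneg_eq_0_iff)
  have "{x0} \<times> K \<subseteq> {z. F z \<noteq> 0}"
  proof clarify
    fix c assume c: "c \<in> K" "F (x0, c) = 0"
    then have "\<forall>k<q. c k = 0" using x0 by (simp add: Feq)
    then show False using c(1) by (simp add: K_def)
  qed
  from Elementary_Topology.tube_lemma[OF K W this] obtain X0 where X0: "x0 \<in> X0" "open X0" "X0 \<times> K \<subseteq> {z. F z \<noteq> 0}"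
    by blast
  have "X0 \<subseteq> ?G"
  proof (intro subsetI CollectI allI impI)
    fix x c k assume x: "x \<in> X0" and c: "\<forall>\<rho>\<in>R. (\<Sum>k<q. M x \<rho> k * c k) = 0" and k: "k < q"
    show "c k = 0"
    proof (rule ccontr)
      assume ck: "c k \<noteq> 0"
      define s where "s = (\<Sum>k<q. \<bar>c k\<bar>)"
      have le: "\<bar>c j\<bar> \<le> s" if "j < q" for j
        unfolding s_def using that by (intro member_le_sum) auto
      have s: "s > 0" using le[OF k] ck by linarith
      define c' where "c' = (\<lambda>j. if j < q then c j / s else 0)"
      have "(\<Sum>k<q. \<bar>c' k\<bar>) = 1"
        using s by (simp add: c'_def s_def[symmetric] abs_divide flip: sum_divide_distrib)
      moreover have "c' \<in> C"
        unfolding C_def c'_def using s le by (auto simp: PiE_iff field_simps abs_le_iff) (use le in fastforce)+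
      ultimately have "c' \<in> K" by (simp add: K_def)
      then have "F (x, c') \<noteq> 0" using X0(3) x by blast
      moreover have "(\<Sum>k<q. M x \<rho> k * c' k) = (\<Sum>k<q. M x \<rho> k * c k) / s" for \<rho>
        unfolding sum_divide_distrib by (intro sum.cong) (auto simp: c'_def)
      ultimately show False using c by (auto simp: Feq)
    qed
  qed
  then show "\<exists>T. open T \<and> x0 \<in> T \<and> T \<subseteq> ?G" using X0 by blast
qed

text \<open>Both independence conditions are trivial kernels: of p stacked over w in the odd-odd
  blocks, with rows indexed by a disjoint sum, and of the transpose of the odd-odd block of
  w.\<close>

lemma open_fiber_dom: "open (fiber_dom m s q)"
proof -
  let ?M = "\<lambda>(x :: point) \<rho> k. case \<rho> of Inl a \<Rightarrow> x (P (Od a) (Od k)) | Inr f \<Rightarrow> x (W (Od f) (Od k))"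
  have "open {x :: point. \<forall>c. (\<forall>\<rho>\<in>{..<m} <+> {..<s}. (\<Sum>k<q. ?M x \<rho> k * c k) = 0) \<longrightarrow> (\<forall>k<q. c k = 0)}"
  proof (rule open_trivial_kernel)
    fix \<rho> :: "nat + nat" and k
    show "continuous_on UNIV (\<lambda>x. ?M x \<rho> k)"
      by (cases \<rho>) (simp_all add: continuous_on_product_coordinates)
  qed simp
  moreover have "open {x :: point. \<forall>c. (\<forall>k\<in>{..<q}. (\<Sum>f<s. x (W (Od f) (Od k)) * c f) = 0) \<longrightarrow> (\<forall>f<s. c f = 0)}"
    by (rule open_trivial_kernel) (simp_all add: continuous_on_product_coordinates)
  moreover have "(\<forall>\<rho>\<in>{..<m} <+> {..<s}. (\<Sum>k<q. ?M x \<rho> k * c k) = 0) \<longleftrightarrow>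
    (\<forall>a<m. (\<Sum>k<q. x (P (Od a) (Od k)) * c k) = 0) \<and> (\<forall>f<s. (\<Sum>k<q. x (W (Od f) (Od k)) * c k) = 0)"
    for x and c by (simp add: Plus_def ball_Un lessThan_def)
  moreover have "(\<Sum>f<s. x (W (Od f) (Od k)) * c f) = (\<Sum>f<s. c f * x (W (Od f) (Od k)))"
    for x :: point and c k by (simp add: mult.commute)
  ultimately show ?thesis
    unfolding fiber_dom_def by (simp only: Collect_conj_eq Ball_def lessThan_iff open_Int)
qed

text \<open>A relatively open chart image is cut out of the coordinate subspace by an open set T.
  Since \<open>base_point n\<close> takes values in that subspace, the region is simply the preimage
  of T.\<close>

lemma open_region:
  assumes "openin (Euclidean_space n) (cmap M i ` cdom M i)"
  shows "open (region n M i UNIV)"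
proof -
  obtain T where T: "open T" "cmap M i ` cdom M i = T \<inter> {x. \<forall>i\<ge>n. x i = 0}"
    using assms by (auto simp: Euclidean_space_def openin_subtopology euclidean_product_topology)
  have "continuous_on UNIV (base_point n)"
    unfolding base_point_def
  proof (rule continuous_on_coordinatewise_then_product)
    fix a
    show "continuous_on UNIV (\<lambda>x :: point. if a < n then x (X (Ev a)) else 0)"
      by (cases "a < n") (simp_all add: continuous_on_product_coordinates)
  qed
  then have "open (base_point n -` T)"
    using T(1) by (rule open_vimage[rotated])
  moreover have "region n M i UNIV = base_point n -` T"
    unfolding region_def using T(2) by (auto simp: base_point_def)
  ultimately show ?thesis by simp
qed

section \<open>Chart formulas as values of the operators\<close>

lemma minus_one_power_fun: "((-1) ^ k :: 'a \<Rightarrow> 'b::ring_1) x = (-1) ^ k"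
  by (induction k) auto

lemma minus_one_power_grass: "(-1 :: grass) ^ k = of_real ((-1) ^ k)"
  by simp

lemma parity_part_zero: "parity_part c 0 = 0"
  by (rule grass_eqI) (simp add: parity_part_def coef_mk_grass coef_simps)

lemma parity_part_one: "parity_part c 1 = (if even c then 1 else 0)"
  by (rule grass_eqI) (auto simp: parity_part_def coef_mk_grass coef_simps, presburger+)

lemma move_one: "move I 1 = 1"
  by (simp add: move_def parity_part_one)

context mixed_domain
begin

text \<open>The chart formula is uncontrolled outside \<open>U\<close>, so it is compared with the
  operator on \<open>U\<close> only; agreement of the arguments there suffices, as \<open>U\<close>
  is open.\<close>

lemma e_local_eq:
  assumes "A \<in> Idx n m" and gg: "\<And>y. y \<in> U \<Longrightarrow> g' y = g y" and y: "y \<in> U"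
  shows "e_local n m r p q (dx_word [A]) g' y = ext_op r A g y"
proof -
  \<comment> \<open>The coefficient 1 is even, so only \<epsilon> equal to \<open>par A\<close>
    contributes.\<close>
  have eps: "(\<Sum>\<epsilon>\<in>{0, 1}. parity_part (\<epsilon> + par A) 1 * c * (-1) ^ (\<epsilon> * par A) * d)
      = (-1) ^ par A * (c * d)" for c d :: grass
    using par_bit[of A] by (auto simp: parity_part_one)
  have "e_local n m r p q (dx_word [A]) g' y = (-1) ^ r * (\<Sum>\<epsilon>\<in>{0, 1}. \<Sum>B\<in>Idx n m. \<Sum>K\<in>Idx p q.
      parity_part (\<epsilon> + par B) (dx_word [A] [B] y) * coord (W (Ev r) K) y * (-1) ^ (\<epsilon> * par B) * D (P B K) g' y)"
    unfolding e_local_def by (simp only: times_fun_apply sum_fun_apply minus_one_power_fun)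
  also have "\<dots> = (-1) ^ r * (\<Sum>\<epsilon>\<in>{0, 1}. \<Sum>B\<in>Idx n m. if B = A then (\<Sum>K\<in>Idx p q.
      parity_part (\<epsilon> + par A) 1 * coord (W (Ev r) K) y * (-1) ^ (\<epsilon> * par A) * D (P A K) g' y) else 0)"
    by (intro arg_cong[of _ _ "(*) ((-1) ^ r)"] sum.cong refl) (auto simp: dx_word_def parity_part_zero)
  also have "\<dots> = (-1) ^ r * (\<Sum>K\<in>Idx p q. \<Sum>\<epsilon>\<in>{0, 1}.
      parity_part (\<epsilon> + par A) 1 * coord (W (Ev r) K) y * (-1) ^ (\<epsilon> * par A) * D (P A K) g' y)"
    using assms(1) by (simp only: sum.delta finite_Idx if_True) (subst sum.swap, rule refl)
  also have "\<dots> = (-1) ^ r * (\<Sum>K\<in>Idx p q. (-1) ^ par A * (coord (W (Ev r) K) y * D (P A K) g' y))"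
    by (simp only: eps)
  also have "\<dots> = (-1) ^ (r + par A) *\<^sub>R (\<Sum>K\<in>Idx p q. coord (W (Ev r) K) y * der (P A K) g y)"
    using y D_cong[OF gg y] unfolding scaleR_conv_of_real
    by (simp add: der_def power_add mult.assoc flip: sum_distrib_left)
  finally show ?thesis
    by (simp add: ext_op_def sscale_def sum_fun_apply)
qed

lemma e_word_eq:
  assumes "set I \<subseteq> Idx n m" and gg: "\<And>y. y \<in> U \<Longrightarrow> g' y = g y" and y: "y \<in> U"
  shows "e_word n m r p q I g' y = ext_word r I g y"
  using assms(1) y
proof (induction I arbitrary: y)
  case (Cons A I)
  then show ?case using e_local_eq[of A "e_word n m r p q I g'" "ext_word r I g" y] by simp
qed (simp add: gg)

text \<open>Stated for two pairs whose products agree on \<open>U\<close>, so that differentials cut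
  off outside their domains can be replaced by the operator expressions.\<close>

lemma act_local_eq:
  assumes "\<And>I y. I \<in> words n m k \<Longrightarrow> y \<in> U \<Longrightarrow> w' I y * g' y = w I y * g y" and y: "y \<in> U"
  shows "act_local n m k r p q w' g' y = (\<Sum>I\<in>words n m k. ext_word r I (w I * g)) y"
  unfolding act_local_def sum_fun_apply
  using assms by (intro sum.cong refl e_word_eq) (auto simp: words_def)

text \<open>Moving \<open>der (X A)\<close> past the w entry in column K gives the sign (-1)^(AK) of
  the defining formula, while the (-1)^A in \<open>dbar_op\<close> cancels the one in
  \<open>ext_op\<close>.\<close>

lemma dbar_local_eq:
  assumes g: "g \<in> ssmooth" and gg: "\<And>y. y \<in> U \<Longrightarrow> g' y = g y" and y: "y \<in> U"
  shows "dbar_local n m r p q g' y = dbar_op r g y"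
proof -
  have D: "D (X A) (D (P A K) g') y = der (X A) (der (P A K) g) y" for A K
    using y D_cong[OF gg] by (simp add: der_def[of "X A"]) (intro D_cong; simp add: der_def)
  have "sscale ((-1) ^ par A) (der (X A) (ext_op r A g)) =
      (\<Sum>K\<in>Idx p q. sscale ((-1) ^ (r + par A * par K)) (coord (W (Ev r) K) * der (X A) (der (P A K) g)))" for A
  proof -
    have "(-1) ^ par A * ((-1) ^ (r + par A) * (-1) ^ (par A * (par K mod 2)))
        = (-1 :: real) ^ (r + par A * par K)" for K
      using par_bit[of A] par_bit[of K] by auto
    then show ?thesis
      using g by (simp add: ext_op_def der_sscale der_sum der_coord_mult ssmooth_intros sscale_simps sscale_sum mult.assoc)
  qed
  then have "dbar_op r g y = (\<Sum>A\<in>Idx n m. \<Sum>K\<in>Idx p q.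
      (-1) ^ (r + par A * par K) *\<^sub>R (coord (W (Ev r) K) y * D (X A) (D (P A K) g') y))"
    by (simp add: dbar_op_def sum_fun_apply sscale_def D)
  also have "\<dots> = dbar_local n m r p q g' y"
  proof -
    have "(-1) ^ (r + par A * par K) *\<^sub>R (c * d) = (-1) ^ r * (c * (-1) ^ (par A * par K) * d)"
      for A K and c d :: grass
      using par_bit[of A] par_bit[of K] minus_one_power_grass[of r]
      by (auto simp: scaleR_conv_of_real)
    then show ?thesis
      unfolding dbar_local_def
      by (simp only: times_fun_apply sum_fun_apply minus_one_power_fun sum_distrib_left)
  qed
  finally show ?thesis ..
qed

text \<open>In the product of dx^I with a 1-form only the left factor I and one-letter right factors
  survive; the coefficient 1 of dx^I moves past the new letter without a sign.\<close>

lemma d_local_eq: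
  assumes J: "J \<in> words n m (Suc k)" and y: "y \<in> U"
  shows "d_local n m k w J y = (\<Sum>I\<in>words n m k. \<Sum>A\<in>Idx n m.
      if sort (I @ [A]) = J then sscale ((-1) ^ k * word_sign (I @ [A])) (der (X A) (w I)) else 0) y"
proof -
  have len: "length J = Suc k" using J by (simp add: words_def)
  have w1: "words n m (Suc 0) = (\<lambda>A. [A]) ` Idx n m"
    by (auto simp: words_def normal_word_def length_Suc_conv)
  have fm: "form_mult n m (dx_word I) (d_fun n m (w I)) J y = (\<Sum>A\<in>Idx n m.
      if sort (I @ [A]) = J then word_sign (I @ [A]) *\<^sub>R der (X A) (w I) y else 0)"
    if I: "I \<in> words n m k" for I
  proof -
    let ?t = "\<lambda>I1 I'. if sort (I1 @ I') = J then word_sign (I1 @ I') *\<^sub>R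
        (move I' (dx_word I I1 y) * d_fun n m (w I) I' y) else 0"
    have lI: "length I = k" using I by (simp add: words_def)
    have t0: "?t I1 I' = 0" if "I1 \<noteq> I" for I1 I'
      using that by (simp add: dx_word_def move_def parity_part_zero)
    have "form_mult n m (dx_word I) (d_fun n m (w I)) J y
        = (\<Sum>k'\<le>Suc k. \<Sum>I1\<in>words n m k'. \<Sum>I'\<in>words n m (Suc k - k'). ?t I1 I')"
      unfolding form_mult_def len ..
    also have "\<dots> = (\<Sum>k'\<le>Suc k. if k' = k then \<Sum>I'\<in>words n m (Suc 0). ?t I I' else 0)"
    proof (intro sum.cong refl)
      fix k' assume "k' \<in> {..Suc k}"
      show "(\<Sum>I1\<in>words n m k'. \<Sum>I'\<in>words n m (Suc k - k'). ?t I1 I')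
          = (if k' = k then \<Sum>I'\<in>words n m (Suc 0). ?t I I' else 0)"
      proof (cases "k' = k")
        case True
        have "(\<Sum>I1\<in>words n m k. \<Sum>I'\<in>words n m (Suc 0). ?t I1 I')
            = (\<Sum>I1\<in>words n m k. if I1 = I then \<Sum>I'\<in>words n m (Suc 0). ?t I I' else 0)"
          by (intro sum.cong refl) (auto intro!: sum.neutral simp: t0 simp del: sum.empty)
        then show ?thesis using True I by simp
      next
        case False
        then have "I1 \<noteq> I" if "I1 \<in> words n m k'" for I1 using that lI by (auto simp: words_def)
        then show ?thesis using False by (auto intro!: sum.neutral simp: t0)
      qed
    qed
    also have "\<dots> = (\<Sum>I'\<in>words n m (Suc 0). ?t I I')" by simp
    also have "\<dots> = (\<Sum>A\<in>Idx n m. ?t I [A])"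
      unfolding w1 by (subst sum.reindex) (auto simp: inj_on_def)
    also have "\<dots> = (\<Sum>A\<in>Idx n m.
      if sort (I @ [A]) = J then word_sign (I @ [A]) *\<^sub>R der (X A) (w I) y else 0)"
      using y by (intro sum.cong refl) (simp add: dx_word_def move_one d_fun_def der_def)
    finally show ?thesis .
  qed
  have "d_local n m k w J y = (\<Sum>I\<in>words n m k. (-1) ^ k * form_mult n m (dx_word I) (d_fun n m (w I)) J y)"
    unfolding d_local_def by (simp only: sum_fun_apply times_fun_apply minus_one_power_fun)
  also have "\<dots> = (\<Sum>I\<in>words n m k. \<Sum>A\<in>Idx n m. (if sort (I @ [A]) = J
      then sscale ((-1) ^ k * word_sign (I @ [A])) (der (X A) (w I)) else 0) y)"
  proof (rule sum.cong[OF refl])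
    fix I assume I: "I \<in> words n m k"
    have sg: "(-1) ^ k * g = (-1) ^ k *\<^sub>R g" for g :: grass
      by (simp add: scaleR_conv_of_real)
    show "(-1) ^ k * form_mult n m (dx_word I) (d_fun n m (w I)) J y =
        (\<Sum>A\<in>Idx n m. (if sort (I @ [A]) = J
          then sscale ((-1) ^ k * word_sign (I @ [A])) (der (X A) (w I)) else 0) y)"
      unfolding fm[OF I] sg scaleR_sum_right
    proof (rule sum.cong[OF refl])
      fix A
      show "(-1) ^ k *\<^sub>R (if sort (I @ [A]) = J then word_sign (I @ [A]) *\<^sub>R der (X A) (w I) y else 0) =
        (if sort (I @ [A]) = J then sscale ((-1) ^ k * word_sign (I @ [A])) (der (X A) (w I)) else 0) y"
        by (cases "sort (I @ [A]) = J") (simp_all add: sscale_def)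
    qed
  qed
  finally show ?thesis by (simp only: sum_fun_apply)
qed

text \<open>For even p entries the function is constant on short segments in that direction; for odd
  ones the corresponding generator does not occur in its values.\<close>

lemma basic_superfun:
  assumes w: "w \<in> superfun (Xvars n m) V" and UV: "U \<subseteq> V"
  shows "basic w"
proof -
  have supp: "\<forall>x\<in>V. \<forall>S. coef (w x) S \<noteq> 0 \<longrightarrow> S \<subseteq> to_nat ` {v \<in> Xvars n m. vpar v = 1}"
    and eq: "\<forall>x\<in>V. \<forall>y\<in>V. (\<forall>v\<in>Xvars n m. vpar v = 0 \<longrightarrow> x v = y v) \<longrightarrow> w x = w y"
    and sm: "\<forall>S. smooth V (\<lambda>x. coef (w x) S)"
    using w unfolding superfun_def mem_Collect_eq by - (elim conjE, assumption)+
  have "w \<in> ssmooth"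
    using sm smooth_subset[OF _ UV] by (simp add: ssmooth_def)
  moreover have "der (P A K) w = 0" for A K
  proof (rule sfun_eqI)
    fix x S assume x: "x \<in> U"
    have "pd (P A K) (\<lambda>y. coef (w y) S) x = 0"
    proof (rule pd_eqI)
      have "eventually (\<lambda>t. coef (w (x(P A K := t))) S = coef (w x) S) (nhds (x (P A K)))"
        using line_in_U[OF x, of "P A K"]
      proof eventually_elim
        case (elim t)
        then have "w (x(P A K := t)) = w x"
          using UV x by (intro eq[rule_format]) (auto simp: Xvars_def)
        then show ?case by simp
      qed
      then show "((\<lambda>t. coef (w (x(P A K := t))) S) has_field_derivative 0) (at (x (P A K)))"
        by (subst DERIV_cong_ev[OF refl _ refl]) auto
    qed
    moreover have "coef (w x) (insert (to_nat (P A K)) S) = 0"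
    proof -
      have "to_nat (P A K) \<notin> to_nat ` {v \<in> Xvars n m. vpar v = 1}"
        by (auto simp: Xvars_def)
      then show ?thesis using supp UV x by blast
    qed
    ultimately show "coef (der (P A K) w x) S = coef (0 x) S"
      using x by (simp add: coef_der coef_simps)
  qed (simp add: der_outside)
  ultimately show ?thesis by (simp add: basic_def)
qed

text \<open>On the open domain nested \<open>D\<close> and nested \<open>der\<close> agree.
  Elsewhere both sides are 0 by the cut-off, which turns the pointwise equation into one of
  functions.\<close>

lemma alternating_mixed:
  assumes "mixed_equations n m r s p q U L"
  shows "alternating L"
  unfolding alternating_def
proof (intro ballI ext)
  fix A B K J x
  assume *: "A \<in> Idx n m" "B \<in> Idx n m" "K \<in> Idx p q" "J \<in> Idx p q"
  have DD: "der u (der v L) x = D u (D v L) x" if "x \<in> U" for u v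
    using that by (simp add: der_def[of u]) (intro D_cong; simp add: der_def)
  show "der (P A K) (der (P B J) L) x
       = sscale (- ((-1) ^ (par A * par B + (par A + par B) * par J))) (der (P B K) (der (P A J) L)) x"
  proof (cases "x \<in> U")
    case True
    then have "D (P A K) (D (P B J) L) x
        + (-1) ^ (par A * par B + (par A + par B) * par J) * D (P B K) (D (P A J) L) x = 0"
      using assms * unfolding mixed_equations_def by blast
    then show ?thesis
      using True by (simp add: DD sscale_def scaleR_conv_of_real eq_neg_iff_add_eq_0)
  qed (simp add: der_outside sscale_def)
qed

end

theorem theorem2p1:
  fixes M :: "('a, 'i) supermfd" and n m k r s p q :: nat
    and \<omega> :: "'i \<Rightarrow> lform" and L :: "'i \<Rightarrow> sfun"
  assumes "supermanifold n m M"
    and "\<omega> \<in> Omega n m M k"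
    and "L \<in> Mixed n m M r s p q"
  shows "dbar n m M (k + r) s p q (act n m M k r s p q \<omega> L) =
         act n m M (k + 1) r s p q (d_form n m M k \<omega>) L +
         (-1) ^ k * act n m M k (r + 1) s p q \<omega> (dbar n m M r s p q L)"
proof (intro ext)
  fix i x
  let ?U = "mdom n m M s q i UNIV"
  show "dbar n m M (k + r) s p q (act n m M k r s p q \<omega> L) i x =
         (act n m M (k + 1) r s p q (d_form n m M k \<omega>) L +
         (-1) ^ k * act n m M k (r + 1) s p q \<omega> (dbar n m M r s p q L)) i x"
  proof (cases "i \<in> charts M \<and> x \<in> ?U")
    case False
    then show ?thesis by (auto simp: dbar_def act_def)
  next
    case True
    then have i: "i \<in> charts M" and x: "x \<in> ?U" by auto
    have "openin (Euclidean_space n) (cmap M i ` cdom M i)"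
      using assms(1) i unfolding supermanifold_def by blast
    then have "open ?U"
      unfolding mdom_def by (intro open_Int open_region open_fiber_dom)
    then interpret mixed_domain ?U n m p q by unfold_locales
    have UV: "?U \<subseteq> region n M i UNIV" by (simp add: mdom_def)
    have w: "basic (\<omega> i I)" for I
      using assms(2) i UV unfolding Omega_def by (intro basic_superfun[of _ "region n M i UNIV"]) blast+
    have "L i \<in> superfun (mvars n m r s p q) ?U" "mixed_equations n m r s p q ?U (L i)"
      using assms(3) i unfolding Mixed_def by blast+
    then have L: "L i \<in> ssmooth" "alternating (L i)"
      unfolding ssmooth_def superfun_def by (blast, intro alternating_mixed)
    \<comment> \<open>An expression known to be smooth that agrees with the action on the domain,
      which is what \<open>dbar_local_eq\<close> asks for.\<close>
    let ?a = "\<Sum>I\<in>words n m k. ext_word r I (\<omega> i I * L i)"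
    let ?d = "\<lambda>J. \<Sum>I\<in>words n m k. \<Sum>A\<in>Idx n m.
      if sort (I @ [A]) = J then sscale ((-1) ^ k * word_sign (I @ [A])) (der (X A) (\<omega> i I)) else 0"
    have a: "?a \<in> ssmooth"
      using w L(1) unfolding basic_def by (intro ssmooth_sum ssmooth_ext_word ssmooth_mult) auto
    have "dbar n m M (k + r) s p q (act n m M k r s p q \<omega> L) i x = dbar_op (k + r) ?a x"
      using i x unfolding dbar_def
      by (simp del: sum_fun_apply) (rule dbar_local_eq[OF a _ x], simp add: act_def act_local_eq)
    also have "\<dots> = ((\<Sum>J\<in>words n m (Suc k). ext_word r J (?d J * L i))
        + sscale ((-1) ^ k) (\<Sum>I\<in>words n m k. ext_word (Suc r) I (\<omega> i I * dbar_op r (L i)))) x"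
      by (subst leibniz_local[where d\<omega> = ?d and \<omega> = "\<omega> i"]) (use w L in simp_all)
    finally have lhs: "dbar n m M (k + r) s p q (act n m M k r s p q \<omega> L) i x
      = (\<Sum>J\<in>words n m (Suc k). ext_word r J (?d J * L i)) x
        + (-1) ^ k *\<^sub>R (\<Sum>I\<in>words n m k. ext_word (Suc r) I (\<omega> i I * dbar_op r (L i))) x"
      by (simp only: plus_fun_apply sscale_def)
    have "(\<Sum>J\<in>words n m (Suc k). ext_word r J (?d J * L i)) x
        = act n m M (k + 1) r s p q (d_form n m M k \<omega>) L i x"
      using i x UV unfolding act_def
      by (simp, subst act_local_eq[where w = ?d and g = "L i"])
        (auto simp: d_form_def d_local_eq subset_iff)
    moreover have "(\<Sum>I\<in>words n m k. ext_word (Suc r) I (\<omega> i I * dbar_op r (L i))) x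
        = act n m M k (r + 1) s p q \<omega> (dbar n m M r s p q L) i x"
    proof -
      have "dbar n m M r s p q L i y = dbar_op r (L i) y" if "y \<in> ?U" for y
        using i that dbar_local_eq[OF L(1) refl that] by (simp add: dbar_def)
      then have "act_local n m k (Suc r) p q (\<omega> i) (dbar n m M r s p q L i) x
          = (\<Sum>I\<in>words n m k. ext_word (Suc r) I (\<omega> i I * dbar_op r (L i))) x"
        by (intro act_local_eq[OF _ x]) simp
      then show ?thesis using i x by (simp only: act_def Suc_eq_plus1) simp
    qed
    moreover have "(-1) ^ k *\<^sub>R g = (-1) ^ k * g" for g :: grass
      by (simp add: scaleR_conv_of_real)
    ultimately show ?thesis
      by (simp only: lhs plus_fun_apply times_fun_apply minus_one_power_fun)
  qed
qed

end
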